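(* For every $k\in\mathbb{N}$, $$\binom{k+1}{2}+\left\lfloor\frac{k}{2}\right\rfloor\ \le\ \left\lceil\frac{|\mathsf{A}_{2,2k-1}|}{3}\right\rceil\ \le\ \mathcal{N}_{\mathsf{A}_{2,2k-1}}\ \le\ \mathcal{C}_{\mathsf{A}_{2,2k-1}} .$$ For $k\ge4$, $$\left\lceil\frac{|\mathsf{A}_{2,2k-1}|}{3}\right\rceil-\left(\binom{k+1}{2}+\left\lfloor\frac{k}{2}\right\rfloor\right)\ \ge\ \frac{(k-2)^2-4}{6} .$$
   Context: $\mathsf{A}_{n,d}:=\{x^\alpha:\alpha\in\mathbb{N}_0^n,\ |\alpha|\le d\}$ is the set of monomials of degree at most $d$ in $n$ variables, considered as functions on $\mathbb{R}^n$. For a finite linearly independent set $\mathsf{A}=\{f_1,\dots,f_m\}$ of smooth functions on $\mathbb{R}^n$: a vector $s\in\mathbb{R}^m$ is a moment sequence of $\mathsf{A}$ if there is a positive Radon measure $\mu$ on $\mathbb{R}^n$ such that all $f_j$ are $\mu$-integrable and $s_j=\int f_j\,d\mu$ for all $j$ ($\mu$ is a representing measure of $s$). A $k$-atomic measure is $\sum_{i=1}^k c_i\delta_{x_i}$ with pairwise different $x_i$ and all $c_i>0$ (the zero measure is $0$-atomic). The Carathéodory number $\mathcal{C}_{\mathsf{A}}$ is the smallest number such that every moment sequence of $\mathsf{A}$ has a $k$-atomic representing measure with $k\le\mathcal{C}_{\mathsf{A}}$. Let $s_{\mathsf{A}}(x)=(f_1(x),\dots,f_m(x))^T$ and $S_{k,\mathsf{A}}(C,X)=\sum_{i=1}^k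 c_i s_{\mathsf{A}}(x_i)$ for $C=(c_1,\dots,c_k)$, $c_i\ge0$, $X=(x_1,\dots,x_k)$, $x_i\in\mathbb{R}^n$, and let $DS_{k,\mathsf{A}}$ be its total derivative with respect to all $c_i$ and all coordinates of all $x_i$. $\mathcal{N}_{\mathsf{A}}$ is the smallest $k\in\mathbb{N}$ such that $DS_{k,\mathsf{A}}(C,X)$ has rank $m$ for some $(C,X)$. *)

theory Defs
  imports "HOL-Analysis.Analysis" "Jordan_Normal_Form.DL_Rank"
begin

text \<open>
  Vectors and matrices of varying size are those of \<open>Jordan_Normal_Form.Matrix\<close>; points of
  Euclidean space are of type \<^typ>\<open>real ^ 'n\<close>.
\<close>

text \<open>
  A fixed, arbitrary ordering of a finite set. It turns a set \<open>A\<close> into \<open>f\<^sub>1, \<dots>, f\<^sub>m\<close> and orders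
  the coordinates of \<^typ>\<open>real ^ 'n\<close>; permuting it only permutes rows or columns below.
\<close>

definition enumeration :: "'a set \<Rightarrow> 'a list" where
  "enumeration A = (SOME xs. distinct xs \<and> set xs = A)"

definition monomials :: "nat \<Rightarrow> (real ^ 'n::finite \<Rightarrow> real) set" where
  "monomials d = {\<lambda>x. \<Prod>i\<in>UNIV. (x $ i) ^ \<alpha> i | \<alpha> :: 'n \<Rightarrow> nat. (\<Sum>i\<in>UNIV. \<alpha> i) \<le> d}"

abbreviation monomials2 :: "nat \<Rightarrow> (real ^ 2 \<Rightarrow> real) set" where
  "monomials2 d \<equiv> monomials d"

definition radon_measure :: "'a::topological_space measure \<Rightarrow> bool" where
  "radon_measure \<mu> \<longleftrightarrow>
     sets \<mu> = sets borel \<and>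
     (\<forall>K. compact K \<longrightarrow> emeasure \<mu> K < \<infinity>) \<and>
     (\<forall>B\<in>sets borel. emeasure \<mu> B = (SUP K\<in>{K. compact K \<and> K \<subseteq> B}. emeasure \<mu> K))"

definition representing_measure ::
  "(real ^ 'n::finite \<Rightarrow> real) set \<Rightarrow> real Matrix.vec \<Rightarrow> (real ^ 'n) measure \<Rightarrow> bool" where
  "representing_measure A s \<mu> \<longleftrightarrow>
     radon_measure \<mu> \<and>
     (\<forall>f\<in>A. integrable \<mu> f) \<and>
     s = vec_of_list (map (\<lambda>f. integral\<^sup>L \<mu> f) (enumeration A))"

definition moment_sequence ::
  "(real ^ 'n::finite \<Rightarrow> real) set \<Rightarrow> real Matrix.vec \<Rightarrow> bool" where
  "moment_sequence A s \<longleftrightarrow> (\<exists>\<mu>. representing_measure A s \<mu>)"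

definition atomic_measure :: "nat \<Rightarrow> 'a::topological_space measure \<Rightarrow> bool" where
  "atomic_measure k \<mu> \<longleftrightarrow>
     sets \<mu> = sets borel \<and>
     (\<exists>(c :: nat \<Rightarrow> real) x.
        inj_on x {..<k} \<and> (\<forall>i<k. c i > 0) \<and>
        (\<forall>B\<in>sets borel. emeasure \<mu> B = (\<Sum>i<k. ennreal (c i) * indicator B (x i))))"

text \<open>
  For a finite linearly independent \<open>A\<close> of smooth functions the minimum exists here by Richter's
  theorem, and in \<open>DS_number\<close> below because some \<open>card A\<close> points have linearly independent
  moment vectors.
\<close>

definition caratheodory_number :: "(real ^ 'n::finite \<Rightarrow> real) set \<Rightarrow> nat" where
  "caratheodory_number A =
     (LEAST N. \<forall>s. moment_sequence A s \<longrightarrow>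
        (\<exists>k\<le>N. \<exists>\<mu>. atomic_measure k \<mu> \<and> representing_measure A s \<mu>))"

definition moment_vector ::
  "(real ^ 'n::finite \<Rightarrow> real) set \<Rightarrow> real ^ 'n \<Rightarrow> real Matrix.vec" where
  "moment_vector A x = vec_of_list (map (\<lambda>f. f x) (enumeration A))"

definition moment_map ::
  "nat \<Rightarrow> (real ^ 'n::finite \<Rightarrow> real) set \<Rightarrow> (nat \<Rightarrow> real) \<Rightarrow> (nat \<Rightarrow> real ^ 'n) \<Rightarrow> real Matrix.vec"
  where
  "moment_map k A C X =
     Matrix.vec (card A) (\<lambda>j. \<Sum>i<k. C i * vec_index (moment_vector A (X i)) j)"

text \<open>
  The total derivative is given by its Jacobian matrix, of size \<open>m \<times> k(n+1)\<close>; the columns are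
  the partial derivatives with respect to \<open>c\<^sub>i\<close> and to the coordinates of \<open>x\<^sub>i\<close>, for \<open>i < k\<close>.
\<close>

definition deriv_vec :: "nat \<Rightarrow> (real \<Rightarrow> real Matrix.vec) \<Rightarrow> real \<Rightarrow> real Matrix.vec" where
  "deriv_vec m \<gamma> t = Matrix.vec m (\<lambda>j. deriv (\<lambda>u. vec_index (\<gamma> u) j) t)"

definition D_moment_map ::
  "nat \<Rightarrow> (real ^ 'n::finite \<Rightarrow> real) set \<Rightarrow> (nat \<Rightarrow> real) \<Rightarrow> (nat \<Rightarrow> real ^ 'n) \<Rightarrow> real Matrix.mat"
  where
  "D_moment_map k A C X =
     mat_of_cols (card A) (concat (map (\<lambda>i.
       deriv_vec (card A) (\<lambda>t. moment_map k A (C(i := t)) X) (C i) #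
       map (\<lambda>l. deriv_vec (card A) (\<lambda>t. moment_map k A C (X(i := X i + t *\<^sub>R axis l 1))) 0)
         (enumeration (UNIV :: 'n set)))
       [0..<k]))"

definition DS_number :: "(real ^ 'n::finite \<Rightarrow> real) set \<Rightarrow> nat" where
  "DS_number A =
     (LEAST k. 1 \<le> k \<and> (\<exists>C X. (\<forall>i<k. 0 \<le> C i) \<and>
        vec_space.rank (card A) (D_moment_map k A C X) = card A))"

end

theory Submission
  imports Defs
begin

text \<open>
  Write \<open>A\<close> for the monomials of degree at most \<open>2k - 1\<close> in two variables, so that
  \<open>card A = k (2k + 1)\<close>. The first and the last inequality are arithmetic: without rounding, the
  difference of the two sides is \<open>k (2k + 1) / 3 - k (k + 1) / 2 - k / 2 = ((k - 2)\<^sup>2 - 4) / 6\<close>,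
  and rounding only increases it. It is greater than \<open>-1\<close>, and after rounding it is an integer, so
  it is nonnegative.
  The inequality \<open>card A / 3 \<le> DS_number A\<close> says that the rank of a matrix is at most its number
  of columns, here three per atom.

  The substance is \<open>DS_number A \<le> caratheodory_number A\<close>. Both numbers are least elements of sets
  that are not visibly nonempty.

  \<^item> The Caratheodory number: an integral of a finite set of functions is a finite nonnegative
    combination of point evaluations (\<open>richter_tchakaloff\<close>, by separation and induction on the
    number of functions), and then of at most \<open>card A\<close> of them (\<open>conic_caratheodory\<close>).

  \<^item> Full rank with \<open>N = caratheodory_number A\<close> atoms: usually this is an application of Sard's
    theorem to the moment map. Since that map is polynomial, algebra suffices. Its components
    \<open>F\<^sub>f (c, x) = \<Sum>i<N. c\<^sub>i f (x\<^sub>i)\<close> for \<open>f \<in> A\<close> are algebraically independent: a polynomial relation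
    between them vanishes on the image of the map, hence, by the choice of \<open>N\<close>, on the whole moment
    cone. The monomials are linearly independent, so the moment cone spans the space and a
    polynomial vanishing on it is zero (\<open>independent_if_moment_cone_covered\<close>). In characteristic
    zero, algebraically independent polynomials have a Jacobian matrix of full rank at a generic
    point (\<open>jacobian_criterion\<close>), and a generic point can be chosen with all \<open>c\<^sub>i > 0\<close>.

  So \<open>N\<close> is one of the numbers whose least element is \<open>DS_number A\<close>, which also shows that the
  latter is attained. Up to the number of monomials, everything holds in any number of variables.
\<close>

section \<open>Finite linear systems and convex cones in coordinates\<close>

text \<open>Gaussian elimination: one unknown is eliminated together with one equation.\<close>

lemma homogeneous_system_nontrivial:
  fixes a :: "'i \<Rightarrow> 'j \<Rightarrow> real"
  assumes "finite I" "finite J" "card I < card J"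
  shows "\<exists>u. (\<exists>j\<in>J. u j \<noteq> 0) \<and> (\<forall>i\<in>I. (\<Sum>j\<in>J. u j * a i j) = 0)"
  using assms
proof (induction I arbitrary: J a rule: finite_induct)
  case empty
  then have "J \<noteq> {}" by auto
  then show ?case by (intro exI[of _ "\<lambda>_. 1"]) auto
next
  case (insert i I)
  show ?case
  proof (cases "\<forall>j\<in>J. a i j = 0")
    case True
    obtain u where "\<exists>j\<in>J. u j \<noteq> 0" "\<forall>i\<in>I. (\<Sum>j\<in>J. u j * a i j) = 0"
      using insert.IH[of J a] insert.prems insert.hyps by auto
    then show ?thesis using True by (intro exI[of _ u]) auto
  next
    case False
    then obtain p where p: "p \<in> J" "a i p \<noteq> 0" by auto
    define b where "b i' j = a i' j - a i j / a i p * a i' p" for i' j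
    have "card I < card (J - {p})" using insert p by auto
    then obtain u where u: "\<exists>j\<in>J - {p}. u j \<noteq> 0"
        "\<forall>i'\<in>I. (\<Sum>j\<in>J - {p}. u j * b i' j) = 0"
      using insert.IH[of "J - {p}" b] insert.prems by auto
    define w where "w = u(p := - (\<Sum>j\<in>J - {p}. u j * a i j) / a i p)"
    have split: "(\<Sum>j\<in>J. w j * a i' j)
        = w p * a i' p + (\<Sum>j\<in>J - {p}. u j * a i' j)" for i'
      using sum.remove[OF insert.prems(1) p(1), of "\<lambda>j. w j * a i' j"] by (simp add: w_def)
    have "(\<Sum>j\<in>J. w j * a i' j) = 0" if "i' \<in> insert i I" for i'
    proof (cases "i' = i")
      case True
      then show ?thesis unfolding split using p by (simp add: w_def)
    next
      case False
      then have "(\<Sum>j\<in>J - {p}. u j * b i' j) = 0" using u that by auto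
      then have "(\<Sum>j\<in>J - {p}. u j * a i' j)
          = (\<Sum>j\<in>J - {p}. u j * a i j) / a i p * a i' p"
        by (simp add: b_def algebra_simps sum_subtractf sum_distrib_left sum_divide_distrib)
      then show ?thesis unfolding split by (simp add: w_def)
    qed
    moreover have "\<exists>j\<in>J. w j \<noteq> 0" using u(1) by (auto simp: w_def)
    ultimately show ?thesis by blast
  qed
qed

text \<open>The separation theorem for a convex cone that is neither closed nor of full dimension, with
  weak inequality. Coordinates are functions on a finite set because the dimension varies. The
  last coordinate is eliminated as in Fourier-Motzkin elimination: a functional that works on the
  slice where this coordinate is zero extends, since mixing a point with positive and a point with
  negative coordinate gives a point of the slice, so that the lower bounds for the new coefficient
  stay below the upper bounds.\<close>

lemma separate_zero_from_convex_cone: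
  fixes K :: "('i \<Rightarrow> real) set"
  assumes "finite I" "K \<noteq> {}"
    and "\<And>x y a b. x \<in> K \<Longrightarrow> y \<in> K \<Longrightarrow> 0 < a \<Longrightarrow> 0 < b \<Longrightarrow> (\<lambda>i. a * x i + b * y i) \<in> K"
    and "\<And>x. x \<in> K \<Longrightarrow> \<exists>i\<in>I. x i \<noteq> 0"
  shows "\<exists>l. (\<exists>i\<in>I. l i \<noteq> 0) \<and> (\<forall>x\<in>K. 0 \<le> (\<Sum>i\<in>I. l i * x i))"
  using assms
proof (induction I arbitrary: K rule: finite_induct)
  case empty
  then show ?case by auto
next
  case (insert j I)
  have coordinate: "(\<Sum>i\<in>insert j I. (if i = j then c else 0) * x i) = c * x j" for c and x :: "'i \<Rightarrow> real"
    using insert.hyps by (simp add: if_distrib[of "\<lambda>c. c * _"] cong: if_cong)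
  consider "\<forall>x\<in>K. 0 \<le> x j" | "\<forall>x\<in>K. x j \<le> 0"
    | "\<exists>x\<in>K. 0 < x j" "\<exists>x\<in>K. x j < 0" by force
  then show ?case
  proof cases
    case 1
    then show ?thesis using coordinate[of 1] by (intro exI[of _ "\<lambda>i. if i = j then 1 else 0"]) auto
  next
    case 2
    then show ?thesis using coordinate[of "-1"] by (intro exI[of _ "\<lambda>i. if i = j then -1 else 0"]) auto
  next
    case 3
    define K0 where "K0 = {x\<in>K. x j = 0}"
    have mixed: "(\<lambda>i. (- y j) * x i + x j * y i) \<in> K0" if "x \<in> K" "0 < x j" "y \<in> K" "y j < 0" for x y
      using insert.prems(2)[of x y "- y j" "x j"] that by (auto simp: K0_def)
    have "\<exists>l. (\<exists>i\<in>I. l i \<noteq> 0) \<and> (\<forall>x\<in>K0. 0 \<le> (\<Sum>i\<in>I. l i * x i))"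
    proof (rule insert.IH)
      show "K0 \<noteq> {}" using 3 mixed by blast
      show "(\<lambda>i. a * x i + b * y i) \<in> K0" if "x \<in> K0" "y \<in> K0" "0 < a" "0 < b" for x y a b
        using insert.prems(2)[of x y a b] that by (auto simp: K0_def)
      show "\<exists>i\<in>I. x i \<noteq> 0" if "x \<in> K0" for x
        using insert.prems(3)[of x] that by (auto simp: K0_def)
    qed
    then obtain l where l: "\<exists>i\<in>I. l i \<noteq> 0" "\<forall>x\<in>K0. 0 \<le> (\<Sum>i\<in>I. l i * x i)" by blast
    define L where "L x = (\<Sum>i\<in>I. l i * x i)" for x
    have cross: "- L x / x j \<le> L y / (- y j)" if "x \<in> K" "0 < x j" "y \<in> K" "y j < 0" for x y
    proof -
      have "0 \<le> L (\<lambda>i. (- y j) * x i + x j * y i)"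
        using mixed[OF that] l(2) by (auto simp: L_def)
      also have "\<dots> = (- y j) * L x + x j * L y"
        by (simp add: L_def sum.distrib sum_distrib_left algebra_simps sum_subtractf sum_negf)
      finally show ?thesis using that by (simp add: field_simps)
    qed
    define P where "P = (\<lambda>x. - L x / x j) ` {x\<in>K. 0 < x j}"
    \<comment> \<open>The least coefficient of coordinate \<open>j\<close> that makes the functional nonnegative on the
      points with positive \<open>j\<close>-th coordinate; \<open>cross\<close> makes it small enough for the others.\<close>
    define c where "c = Sup P"
    have "P \<noteq> {}" using 3 by (auto simp: P_def)
    obtain y0 where y0: "y0 \<in> K" "y0 j < 0" using 3 by blast
    have bdd: "bdd_above P" unfolding P_def
    proof (rule bdd_aboveI2)
      fix x assume "x \<in> {x\<in>K. 0 < x j}"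
      then show "- L x / x j \<le> L y0 / (- y0 j)" using cross y0 by blast
    qed
    have nonneg: "0 \<le> c * x j + L x" if x: "x \<in> K" for x
    proof -
      consider "x j = 0" | "0 < x j" | "x j < 0" by linarith
      then show ?thesis
      proof cases
        case 1
        then show ?thesis using l(2) x by (auto simp: K0_def L_def)
      next
        case 2
        then have "- L x / x j \<le> c" unfolding c_def using x bdd by (intro cSup_upper) (auto simp: P_def)
        then show ?thesis using 2 by (simp add: field_simps)
      next
        case neg: 3
        have "c \<le> L x / (- x j)" unfolding c_def
          using \<open>P \<noteq> {}\<close> by (rule cSup_least) (use cross x neg in \<open>unfold P_def, blast\<close>)
        then show ?thesis using neg by (simp add: field_simps)
      qed
    qed
    have "(\<Sum>i\<in>insert j I. (l(j := c)) i * x i) = c * x j + L x" for x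
      using insert.hyps by (auto simp: L_def intro!: sum.cong)
    moreover have "\<exists>i\<in>insert j I. (l(j := c)) i \<noteq> 0" using l(1) insert.hyps by auto
    ultimately show ?thesis using nonneg by (intro exI[of _ "l(j := c)"]) auto
  qed
qed

text \<open>A vector \<open>s\<close> outside the cone \<open>H\<close> generated by the \<open>g _ x\<close> is separated from it by applying
  the previous lemma to \<open>{v - t s | v \<in> H, t > 0}\<close>, which does not contain zero.\<close>

lemma separate_from_cone_hull:
  fixes g :: "'i \<Rightarrow> 'a \<Rightarrow> real"
  assumes "finite I"
    and "\<nexists>T c. finite T \<and> T \<subseteq> X \<and> (\<forall>x\<in>T. 0 \<le> c x) \<and> (\<forall>i\<in>I. s i = (\<Sum>x\<in>T. c x * g i x))"
  shows "\<exists>l. (\<exists>i\<in>I. l i \<noteq> 0) \<and> (\<forall>x\<in>X. 0 \<le> (\<Sum>i\<in>I. l i * g i x)) \<and> (\<Sum>i\<in>I. l i * s i) \<le> 0"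
proof -
  define H where "H = {v. \<exists>T c. finite T \<and> T \<subseteq> X \<and> (\<forall>x\<in>T. 0 \<le> c x) \<and> (\<forall>i\<in>I. v i = (\<Sum>x\<in>T. c x * g i x))}"
  have H_zero: "(\<lambda>_. 0) \<in> H" by (auto simp: H_def intro!: exI[of _ "{}"])
  have H_point: "(\<lambda>i. g i x) \<in> H" if "x \<in> X" for x
    using that unfolding H_def by (auto intro!: exI[of _ "{x}"] exI[of _ "\<lambda>_. 1"])
  have H_comb: "(\<lambda>i. a * v i + b * w i) \<in> H" if vw: "v \<in> H" "w \<in> H" and ab: "0 \<le> a" "0 \<le> b" for v w a b
  proof -
    obtain T c where T: "finite T" "T \<subseteq> X" "\<forall>x\<in>T. 0 \<le> c x" "\<forall>i\<in>I. v i = (\<Sum>x\<in>T. c x * g i x)"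
      using vw(1) by (auto simp: H_def)
    obtain U d where U: "finite U" "U \<subseteq> X" "\<forall>x\<in>U. 0 \<le> d x" "\<forall>i\<in>I. w i = (\<Sum>x\<in>U. d x * g i x)"
      using vw(2) by (auto simp: H_def)
    define e where "e x = a * (if x \<in> T then c x else 0) + b * (if x \<in> U then d x else 0)" for x
    have "(\<Sum>x\<in>T \<union> U. e x * g i x) = a * v i + b * w i" if "i \<in> I" for i
    proof -
      have "(\<Sum>x\<in>T \<union> U. e x * g i x) = a * (\<Sum>x\<in>T \<union> U. if x \<in> T then c x * g i x else 0)
          + b * (\<Sum>x\<in>T \<union> U. if x \<in> U then d x * g i x else 0)"
        unfolding sum_distrib_left sum.distrib[symmetric] e_def
        by (intro sum.cong) (auto simp: algebra_simps)
      also have "\<dots> = a * v i + b * w i"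
        using T U that by (simp add: sum.If_cases Int_absorb1 Int_absorb2 Un_Int_distrib)
      finally show ?thesis .
    qed
    then show ?thesis unfolding H_def using T U ab
      by (intro CollectI exI[of _ "T \<union> U"] exI[of _ e]) (auto simp: e_def)
  qed
  define K where "K = {\<lambda>i. v i - t * s i | v t. v \<in> H \<and> 0 < t}"
  have "\<exists>l. (\<exists>i\<in>I. l i \<noteq> 0) \<and> (\<forall>x\<in>K. 0 \<le> (\<Sum>i\<in>I. l i * x i))"
  proof (rule separate_zero_from_convex_cone[OF assms(1)])
    have "(\<lambda>i. 0 - 1 * s i) \<in> K" unfolding K_def
      by (rule CollectI, rule exI[of _ "\<lambda>_. 0"], rule exI[of _ 1]) (simp add: H_zero)
    then show "K \<noteq> {}" by blast
    show "(\<lambda>i. a * x i + b * y i) \<in> K" if xy: "x \<in> K" "y \<in> K" and ab: "0 < a" "0 < b" for x y a b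
    proof -
      obtain v t where v: "x = (\<lambda>i. v i - t * s i)" "v \<in> H" "0 < t" using xy by (auto simp: K_def)
      obtain w u where w: "y = (\<lambda>i. w i - u * s i)" "w \<in> H" "0 < u" using xy by (auto simp: K_def)
      have "(\<lambda>i. a * x i + b * y i) = (\<lambda>i. (a * v i + b * w i) - (a * t + b * u) * s i)"
        by (simp add: v w algebra_simps)
      moreover have "0 < a * t + b * u" using v w ab by (simp add: add_pos_pos)
      ultimately show ?thesis unfolding K_def using H_comb[OF v(2) w(2)] ab
        by (intro CollectI exI[of _ "\<lambda>i. a * v i + b * w i"] exI[of _ "a * t + b * u"]) auto
    qed
    show "\<exists>i\<in>I. x i \<noteq> 0" if xK: "x \<in> K" for x
    proof (rule ccontr)
      assume contra: "\<not> (\<exists>i\<in>I. x i \<noteq> 0)"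
      obtain v t where v: "x = (\<lambda>i. v i - t * s i)" "v \<in> H" "0 < t" using xK by (auto simp: K_def)
      have "(\<lambda>i. (1 / t) * v i + 0 * v i) \<in> H" using v by (intro H_comb) auto
      then obtain T c where T: "finite T" "T \<subseteq> X" "\<forall>x\<in>T. 0 \<le> c x"
          "\<forall>i\<in>I. (1 / t) * v i + 0 * v i = (\<Sum>x\<in>T. c x * g i x)" by (auto simp: H_def)
      have "s i = (1 / t) * v i + 0 * v i" if "i \<in> I" for i
        using contra v that by (auto simp: field_simps)
      then have "\<forall>i\<in>I. s i = (\<Sum>x\<in>T. c x * g i x)" using T by simp
      then show False using assms(2) T(1-3) by blast
    qed
  qed
  then obtain l where l: "\<exists>i\<in>I. l i \<noteq> 0" "\<forall>x\<in>K. 0 \<le> (\<Sum>i\<in>I. l i * x i)" by blast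
  define L where "L v = (\<Sum>i\<in>I. l i * v i)" for v
  have LK: "0 \<le> L v - t * L s" if "v \<in> H" "0 < t" for v t
  proof -
    have "0 \<le> L (\<lambda>i. v i - t * s i)" using l(2) that by (auto simp: K_def L_def)
    then show ?thesis by (simp add: L_def algebra_simps sum_subtractf sum_distrib_left)
  qed
  have "0 \<le> L v" if "v \<in> H" for v
  proof (rule ccontr)
    assume n: "\<not> 0 \<le> L v"
    \<comment> \<open>So small that \<open>t * \<bar>L s\<bar> < - L v\<close>, which contradicts \<open>LK\<close>.\<close>
    define t where "t = - L v / (2 * (1 + \<bar>L s\<bar>))"
    have "0 < t" using n by (simp add: t_def divide_neg_pos)
    have "t * (2 * (1 + \<bar>L s\<bar>)) = - L v" unfolding t_def by (simp add: field_simps add_pos_nonneg)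
    then have "- 2 * t - 2 * (t * \<bar>L s\<bar>) = L v" by (simp add: algebra_simps)
    moreover have "- t * L s \<le> t * \<bar>L s\<bar>" using \<open>0 < t\<close> by (simp add: mult_left_mono[of "- L s" "\<bar>L s\<bar>" t, simplified])
    moreover have "0 \<le> t * \<bar>L s\<bar>" using \<open>0 < t\<close> by simp
    ultimately show False using LK[OF that \<open>0 < t\<close>] \<open>0 < t\<close> by linarith
  qed
  moreover have "L s \<le> 0" using LK[OF H_zero, of 1] by (simp add: L_def)
  ultimately show ?thesis using l(1) H_point unfolding L_def by blast
qed

text \<open>While there are more points than coordinates, a linear dependence between them can be
  subtracted until the first weight becomes zero.\<close>

lemma conic_caratheodory:
  fixes g :: "'i \<Rightarrow> 'a \<Rightarrow> real"
  assumes "finite I" "finite T" "\<forall>x\<in>T. 0 \<le> c x" "\<forall>i\<in>I. s i = (\<Sum>x\<in>T. c x * g i x)"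
  shows "\<exists>T' c'. T' \<subseteq> T \<and> card T' \<le> card I \<and> (\<forall>x\<in>T'. 0 < c' x) \<and> (\<forall>i\<in>I. s i = (\<Sum>x\<in>T'. c' x * g i x))"
  using assms(2-)
proof (induction "card T" arbitrary: T c rule: less_induct)
  case less
  have drop: ?case if d: "\<forall>x\<in>T. 0 \<le> d x" "\<forall>i\<in>I. s i = (\<Sum>x\<in>T. d x * g i x)" and p: "p \<in> T" "d p = 0" for d p
  proof -
    have "(\<Sum>x\<in>T - {p}. d x * g i x) = (\<Sum>x\<in>T. d x * g i x)" for i
      using p less.prems by (simp add: sum.remove)
    moreover have "card (T - {p}) < card T" by (rule card_Diff1_less[OF less.prems(1) p(1)])
    ultimately have "\<exists>T' c'. T' \<subseteq> T - {p} \<and> card T' \<le> card I \<and> (\<forall>x\<in>T'. 0 < c' x) \<and> (\<forall>i\<in>I. s i = (\<Sum>x\<in>T'. c' x * g i x))"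
      using less.prems d by (intro less.hyps[of "T - {p}" d]) auto
    then show ?thesis by blast
  qed
  show ?case
  proof (cases "\<exists>p\<in>T. c p = 0")
    case True
    then show ?thesis using drop[of c] less.prems by blast
  next
    case False
    then have pos: "\<forall>x\<in>T. 0 < c x" using less.prems by force
    show ?thesis
    proof (cases "card T \<le> card I")
      case True
      then show ?thesis using pos less.prems by blast
    next
      case False
      then obtain u0 where u0: "\<exists>x\<in>T. u0 x \<noteq> 0" "\<forall>i\<in>I. (\<Sum>x\<in>T. u0 x * g i x) = 0"
        using homogeneous_system_nontrivial[OF assms(1) less.prems(1), of g] by auto
      obtain u where u: "\<exists>x\<in>T. 0 < u x" "\<forall>i\<in>I. (\<Sum>x\<in>T. u x * g i x) = 0"
      proof (cases "\<exists>x\<in>T. 0 < u0 x")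
        case True
        then show ?thesis using that u0 by blast
      next
        case False
        then show ?thesis using u0 by (intro that[of "\<lambda>x. - u0 x"]) (force simp: sum_negf)+
      qed
      define U where "U = {x\<in>T. 0 < u x}"
      have "finite U" "U \<noteq> {}" using less.prems u by (auto simp: U_def)
      then obtain p where p: "p \<in> U" "\<forall>x\<in>U. c p / u p \<le> c x / u x"
        using arg_min_if_finite[of U "\<lambda>x. c x / u x"] by (meson not_le)
      \<comment> \<open>The largest multiple of \<open>u\<close> that can be subtracted from \<open>c\<close>; it makes the weight of \<open>p\<close> zero.\<close>
      define t where "t = c p / u p"
      have "0 \<le> t" using p less.prems by (auto simp: t_def U_def)
      have "0 \<le> c x - t * u x" if "x \<in> T" for x
      proof (cases "0 < u x")
        case True
        then have "t \<le> c x / u x" using p that by (auto simp: t_def U_def)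
        then show ?thesis using True by (simp add: field_simps)
      next
        case False
        then have "t * u x \<le> 0" using \<open>0 \<le> t\<close> by (simp add: mult_nonneg_nonpos)
        then show ?thesis using pos that by force
      qed
      moreover have "s i = (\<Sum>x\<in>T. (c x - t * u x) * g i x)" if "i \<in> I" for i
      proof -
        have "(\<Sum>x\<in>T. (c x - t * u x) * g i x) = (\<Sum>x\<in>T. c x * g i x) - t * (\<Sum>x\<in>T. u x * g i x)"
          by (simp add: algebra_simps sum_subtractf sum_distrib_left)
        then show ?thesis using less.prems u that by simp
      qed
      ultimately show ?thesis using p by (intro drop[of "\<lambda>x. c x - t * u x" p]) (auto simp: t_def U_def)
    qed
  qed
qed

section \<open>Finitely atomic representing measures\<close>

text \<open>If the vector of integrals were outside the cone generated by the points of \<open>X\<close>, a separating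
  functional would give a combination \<open>L\<close> of the functions that is nonnegative on \<open>X\<close> and has
  nonpositive integral, hence vanishes almost everywhere. On the set where \<open>L\<close> is zero, one of the
  functions is a combination of the others, and the induction hypothesis on this smaller set
  represents all integrals after all.\<close>

lemma richter_tchakaloff:
  fixes A :: "('a \<Rightarrow> real) set"
  assumes "finite A" "X \<in> sets M" "AE x in M. x \<in> X" "\<And>f. f \<in> A \<Longrightarrow> integrable M f"
  shows "\<exists>T c. finite T \<and> T \<subseteq> X \<and> (\<forall>x\<in>T. 0 \<le> c x) \<and> (\<forall>f\<in>A. integral\<^sup>L M f = (\<Sum>x\<in>T. c x * f x))"
  using assms
proof (induction "card A" arbitrary: A X rule: less_induct)
  case less
  note int = less.prems(4)
  show ?case
  proof (rule ccontr)
    assume contra: "\<not> ?case"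
    obtain l where l: "\<exists>f\<in>A. l f \<noteq> 0" "\<forall>x\<in>X. 0 \<le> (\<Sum>f\<in>A. l f * f x)"
      "(\<Sum>f\<in>A. l f * integral\<^sup>L M f) \<le> 0"
      using separate_from_cone_hull[OF less.prems(1), of X "integral\<^sup>L M" "\<lambda>f. f"] contra by blast
    define L where "L x = (\<Sum>f\<in>A. l f * f x)" for x
    have L_int: "integrable M L" unfolding L_def using int by (intro Bochner_Integration.integrable_sum) auto
    have "integral\<^sup>L M L = (\<Sum>f\<in>A. l f * integral\<^sup>L M f)"
      unfolding L_def using int by (subst Bochner_Integration.integral_sum) auto
    then have "integral\<^sup>L M L \<le> 0" using l(3) by simp
    moreover have L_nonneg: "AE x in M. 0 \<le> L x" using less.prems(3) by eventually_elim (use l(2) L_def in auto)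
    ultimately have "integral\<^sup>L M L = 0" using integral_nonneg_AE[OF L_nonneg] by simp
    then have L_zero: "AE x in M. L x = 0" using integral_nonneg_eq_0_iff_AE[OF L_int L_nonneg] by blast
    define X' where "X' = {x\<in>space M. x \<in> X \<and> L x = 0}"
    have X': "X' \<in> sets M" "AE x in M. x \<in> X'"
    proof -
      have [measurable]: "L \<in> borel_measurable M" "X \<in> sets M" using L_int less.prems(2) by auto
      show "X' \<in> sets M" unfolding X'_def by measurable
      show "AE x in M. x \<in> X'" using less.prems(3) L_zero AE_space by eventually_elim (simp add: X'_def)
    qed
    obtain f0 where f0: "f0 \<in> A" "l f0 \<noteq> 0" using l(1) by blast
    define A' where "A' = A - {f0}"
    define r where "r f = - l f / l f0" for f
    have f0_eq: "f0 x = (\<Sum>f\<in>A'. r f * f x)" if "L x = 0" for x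
    proof -
      have "l f0 * f0 x + (\<Sum>f\<in>A'. l f * f x) = 0"
        using that sum.remove[OF less.prems(1) f0(1), of "\<lambda>f. l f * f x"] by (simp add: L_def A'_def)
      then have "f0 x = - (\<Sum>f\<in>A'. l f * f x) / l f0" using f0(2) by (simp add: field_simps)
      then show ?thesis by (simp add: r_def sum_negf sum_divide_distrib)
    qed
    have "card A' < card A" unfolding A'_def by (rule card_Diff1_less[OF less.prems(1) f0(1)])
    moreover have "finite A'" "\<And>f. f \<in> A' \<Longrightarrow> integrable M f" using less.prems by (auto simp: A'_def)
    ultimately obtain T c where T: "finite T" "T \<subseteq> X'" "\<forall>x\<in>T. 0 \<le> c x"
      "\<forall>f\<in>A'. integral\<^sup>L M f = (\<Sum>x\<in>T. c x * f x)"
      using less.hyps[of A' X'] X' by metis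
    have "integral\<^sup>L M f0 = integral\<^sup>L M (\<lambda>x. \<Sum>f\<in>A'. r f * f x)"
    proof (rule integral_cong_AE)
      show "f0 \<in> borel_measurable M" using int[OF f0(1)] by auto
      have [measurable]: "f \<in> borel_measurable M" if "f \<in> A'" for f using int that by (auto simp: A'_def)
      show "(\<lambda>x. \<Sum>f\<in>A'. r f * f x) \<in> borel_measurable M" by measurable
      show "AE x in M. f0 x = (\<Sum>f\<in>A'. r f * f x)" using L_zero by eventually_elim (rule f0_eq)
    qed
    also have "\<dots> = (\<Sum>f\<in>A'. r f * integral\<^sup>L M f)"
      using int by (subst Bochner_Integration.integral_sum) (auto simp: A'_def)
    also have "\<dots> = (\<Sum>f\<in>A'. \<Sum>x\<in>T. r f * (c x * f x))" using T(4) by (simp add: sum_distrib_left)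
    also have "\<dots> = (\<Sum>x\<in>T. c x * (\<Sum>f\<in>A'. r f * f x))"
      by (subst sum.swap) (simp add: sum_distrib_left mult_ac)
    also have "\<dots> = (\<Sum>x\<in>T. c x * f0 x)"
      using T(2) by (intro sum.cong refl) (auto simp: X'_def f0_eq)
    finally have "\<forall>f\<in>A. integral\<^sup>L M f = (\<Sum>x\<in>T. c x * f x)" using T(4) by (auto simp: A'_def)
    then show False using contra T(1-3) unfolding X'_def by blast
  qed
qed

text \<open>Defined as an image of a weighted counting measure, which gives its integrals at once; it is
  \<open>\<Sum>i<k. c\<^sub>i \<delta>\<^bsub>x\<^sub>i\<^esub>\<close>, where the points may coincide.\<close>

definition atoms_measure :: "nat \<Rightarrow> (nat \<Rightarrow> real) \<Rightarrow> (nat \<Rightarrow> 'a::topological_space) \<Rightarrow> 'a measure" where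
  "atoms_measure k c x = distr (point_measure {..<k} (\<lambda>i. ennreal (c i))) borel x"

lemma sets_atoms_measure [simp]: "sets (atoms_measure k c x) = sets borel"
  by (simp add: atoms_measure_def)

lemma emeasure_atoms_measure:
  fixes x :: "nat \<Rightarrow> 'a::topological_space"
  assumes "B \<in> sets borel"
  shows "emeasure (atoms_measure k c x) B = (\<Sum>i<k. ennreal (c i) * indicator B (x i))"
proof -
  have "emeasure (atoms_measure k c x) B
      = emeasure (point_measure {..<k} (\<lambda>i. ennreal (c i))) (x -` B \<inter> {..<k})"
    unfolding atoms_measure_def using assms
    by (subst emeasure_distr) (auto simp: space_point_measure)
  also have "\<dots> = (\<Sum>i\<in>x -` B \<inter> {..<k}. ennreal (c i))"
    by (rule emeasure_point_measure_finite) auto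
  also have "\<dots> = (\<Sum>i<k. ennreal (c i) * indicator B (x i))"
    by (intro sum.mono_neutral_cong_left) (auto simp: indicator_def)
  finally show ?thesis .
qed

lemma integral_atoms_measure:
  fixes f :: "'a::topological_space \<Rightarrow> real"
  assumes "f \<in> borel_measurable borel" "\<And>i. i < k \<Longrightarrow> 0 \<le> c i"
  shows "integrable (atoms_measure k c x) f"
    and "integral\<^sup>L (atoms_measure k c x) f = (\<Sum>i<k. c i * f (x i))"
proof -
  show "integrable (atoms_measure k c x) f" unfolding atoms_measure_def
    by (subst integrable_distr_eq) (auto simp: assms space_point_measure intro!: integrable_point_measure_finite)
  have "integral\<^sup>L (atoms_measure k c x) f = integral\<^sup>L (point_measure {..<k} (\<lambda>i. ennreal (c i))) (\<lambda>i. f (x i))"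
    unfolding atoms_measure_def by (subst integral_distr) (auto simp: assms space_point_measure)
  also have "\<dots> = (\<Sum>i<k. c i * f (x i))"
    using assms(2) by (subst lebesgue_integral_point_measure_finite) auto
  finally show "integral\<^sup>L (atoms_measure k c x) f = (\<Sum>i<k. c i * f (x i))" .
qed

text \<open>Inner regularity is attained: the atoms inside a Borel set form a finite, hence compact, set.\<close>

lemma radon_atoms_measure: "radon_measure (atoms_measure k c (x :: nat \<Rightarrow> 'a::t2_space))"
  unfolding radon_measure_def
proof (intro conjI allI impI ballI)
  show "sets (atoms_measure k c x) = sets borel" by simp
  show "emeasure (atoms_measure k c x) K < \<infinity>" if "compact K" for K
    using that by (simp add: emeasure_atoms_measure borel_compact ennreal_mult_less_top
      ennreal_sum_less_top less_top[symmetric] indicator_def)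
  show "emeasure (atoms_measure k c x) B = (SUP K\<in>{K. compact K \<and> K \<subseteq> B}. emeasure (atoms_measure k c x) K)"
    if B: "B \<in> sets borel" for B
  proof (rule antisym)
    define K where "K = x ` {i\<in>{..<k}. x i \<in> B}"
    have K: "compact K" "K \<subseteq> B" by (auto simp: K_def intro: finite_imp_compact)
    have "emeasure (atoms_measure k c x) B = emeasure (atoms_measure k c x) K"
      using K B by (simp add: emeasure_atoms_measure borel_compact)
        (auto simp: K_def indicator_def intro!: sum.cong)
    then show "emeasure (atoms_measure k c x) B \<le> (SUP K\<in>{K. compact K \<and> K \<subseteq> B}. emeasure (atoms_measure k c x) K)"
      using K by (auto intro: SUP_upper2)
    show "(SUP K\<in>{K. compact K \<and> K \<subseteq> B}. emeasure (atoms_measure k c x) K) \<le> emeasure (atoms_measure k c x) B"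
      using B by (auto intro!: SUP_least emeasure_mono)
  qed
qed

lemma atomic_measure_iff:
  fixes \<mu> :: "'a::topological_space measure"
  shows "atomic_measure k \<mu> \<longleftrightarrow>
    (\<exists>c x. inj_on x {..<k} \<and> (\<forall>i<k. 0 < c i) \<and> \<mu> = atoms_measure k c x)"
proof
  assume "atomic_measure k \<mu>"
  then obtain c x where cx: "sets \<mu> = sets borel" "inj_on x {..<k}" "\<forall>i<k. 0 < c i"
    "\<forall>B\<in>sets borel. emeasure \<mu> B = (\<Sum>i<k. ennreal (c i) * indicator B (x i))"
    unfolding atomic_measure_def by blast
  then have "\<mu> = atoms_measure k c x"
    by (intro measure_eqI) (auto simp: emeasure_atoms_measure)
  then show "\<exists>c x. inj_on x {..<k} \<and> (\<forall>i<k. 0 < c i) \<and> \<mu> = atoms_measure k c x" using cx by blast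
next
  assume "\<exists>c x. inj_on x {..<k} \<and> (\<forall>i<k. 0 < c i) \<and> \<mu> = atoms_measure k c x"
  then obtain c x where cx: "inj_on x {..<k}" "\<forall>i<k. 0 < c i" "\<mu> = atoms_measure k c x" by blast
  then have "\<forall>B\<in>sets borel. emeasure \<mu> B = (\<Sum>i<k. ennreal (c i) * indicator B (x i))"
    using emeasure_atoms_measure by blast
  then show "atomic_measure k \<mu>" unfolding atomic_measure_def using cx by auto
qed

lemma enumeration:
  assumes "finite A" shows "distinct (enumeration A)" "set (enumeration A) = A"
proof -
  have "\<exists>xs. distinct xs \<and> set xs = A" using finite_distinct_list[OF assms] by blast
  from someI_ex[OF this] show "distinct (enumeration A)" "set (enumeration A) = A"
    by (simp_all add: enumeration_def)
qed

definition vector_of_values :: "('a \<Rightarrow> real) set \<Rightarrow> (('a \<Rightarrow> real) \<Rightarrow> real) \<Rightarrow> real Matrix.vec" where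
  "vector_of_values A s = vec_of_list (map s (enumeration A))"

lemma vector_of_values_eq_iff:
  assumes "finite A"
  shows "vector_of_values A s = vector_of_values A t \<longleftrightarrow> (\<forall>f\<in>A. s f = t f)"
proof -
  have "vector_of_values A s = vector_of_values A t \<longleftrightarrow> map s (enumeration A) = map t (enumeration A)"
    unfolding vector_of_values_def using arg_cong[of _ _ list_of_vec] list_vec by metis
  then show ?thesis using enumeration(2)[OF assms] by simp
qed

lemma representing_measure_atoms_measure:
  fixes A :: "(real ^ 'n::finite \<Rightarrow> real) set"
  assumes "finite A" "A \<subseteq> borel_measurable borel" "\<And>i. i < k \<Longrightarrow> 0 \<le> c i"
  shows "representing_measure A (vector_of_values A s) (atoms_measure k c x)
    \<longleftrightarrow> (\<forall>f\<in>A. s f = (\<Sum>i<k. c i * f (x i)))"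
proof -
  have int: "integrable (atoms_measure k c x) f"
      "integral\<^sup>L (atoms_measure k c x) f = (\<Sum>i<k. c i * f (x i))" if "f \<in> A" for f
    by (rule integral_atoms_measure[OF subsetD[OF assms(2) that] assms(3)]; assumption)+
  have "representing_measure A (vector_of_values A s) (atoms_measure k c x) \<longleftrightarrow>
      vector_of_values A s = vector_of_values A (integral\<^sup>L (atoms_measure k c x))"
    using int(1) by (simp add: representing_measure_def radon_atoms_measure vector_of_values_def)
  then show ?thesis using int(2) by (simp add: vector_of_values_eq_iff[OF assms(1)])
qed

lemma reindex_atoms:
  assumes "finite T"
  obtains x where "inj_on x {..<card T}" "x ` {..<card T} = T"
  using ex_bij_betw_nat_finite[OF assms] unfolding bij_betw_def atLeast0LessThan by blast

lemma moment_sequence_has_atomic_measure: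
  fixes A :: "(real ^ 'n::finite \<Rightarrow> real) set"
  assumes "finite A" "A \<subseteq> borel_measurable borel" "moment_sequence A s"
  shows "\<exists>k\<le>card A. \<exists>\<mu>. atomic_measure k \<mu> \<and> representing_measure A s \<mu>"
proof -
  obtain M where M: "radon_measure M" "\<And>f. f \<in> A \<Longrightarrow> integrable M f" "s = vector_of_values A (integral\<^sup>L M)"
    using assms(3) by (auto simp: moment_sequence_def representing_measure_def vector_of_values_def)
  obtain T0 c0 where T0: "finite T0" "\<forall>x\<in>T0. 0 \<le> c0 x" "\<forall>f\<in>A. integral\<^sup>L M f = (\<Sum>x\<in>T0. c0 x * f x)"
    using richter_tchakaloff[OF assms(1) sets.top AE_space M(2)] by blast
  obtain T c where T: "T \<subseteq> T0" "card T \<le> card A" "\<forall>x\<in>T. 0 < c x"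
    "\<forall>f\<in>A. integral\<^sup>L M f = (\<Sum>x\<in>T. c x * f x)"
    using conic_caratheodory[OF assms(1) T0] by blast
  have "finite T" using T(1) T0(1) finite_subset by blast
  then obtain x where x: "inj_on x {..<card T}" "x ` {..<card T} = T" by (rule reindex_atoms)
  have "(\<Sum>y\<in>T. c y * f y) = (\<Sum>i<card T. c (x i) * f (x i))" for f
    by (subst x(2)[symmetric]) (simp add: sum.reindex[OF x(1)])
  moreover have pos: "0 < c (x i)" if "i < card T" for i using that T(3) x(2) by blast
  ultimately have "representing_measure A s (atoms_measure (card T) (\<lambda>i. c (x i)) x)"
    unfolding M(3) using T(4) pos
    by (subst representing_measure_atoms_measure[OF assms(1,2)]) (auto intro: less_imp_le)
  moreover have "atomic_measure (card T) (atoms_measure (card T) (\<lambda>i. c (x i)) x)"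
    unfolding atomic_measure_iff using x(1) pos by (intro exI[of _ "\<lambda>i. c (x i)"] exI[of _ x]) auto
  ultimately show ?thesis using T(2) by blast
qed

text \<open>Every point of the cone generated by the moment vectors is a moment sequence, so the defining
  property of the Caratheodory number applies to it. Zero weights pad the sum to exactly
  \<open>caratheodory_number A\<close> atoms. The minimum defining this number exists by
  \<open>moment_sequence_has_atomic_measure\<close>.\<close>

lemma caratheodory_number_attained:
  fixes A :: "(real ^ 'n::finite \<Rightarrow> real) set"
  assumes "finite A" "A \<subseteq> borel_measurable borel"
    and "finite T" "\<forall>x\<in>T. 0 \<le> w x"
  shows "\<exists>c x. (\<forall>i. 0 \<le> c i) \<and>
    (\<forall>f\<in>A. (\<Sum>x\<in>T. w x * f x) = (\<Sum>i<caratheodory_number A. c i * f (x i)))"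
proof -
  let ?s = "vector_of_values A (\<lambda>f. \<Sum>x\<in>T. w x * f x)"
  obtain y where y: "inj_on y {..<card T}" "y ` {..<card T} = T" by (rule reindex_atoms[OF assms(3)])
  have "(\<Sum>x\<in>T. w x * f x) = (\<Sum>i<card T. w (y i) * f (y i))" for f
    by (subst y(2)[symmetric]) (simp add: sum.reindex[OF y(1)])
  then have "representing_measure A ?s (atoms_measure (card T) (\<lambda>i. w (y i)) y)"
    using assms(4) y(2) by (subst representing_measure_atoms_measure[OF assms(1,2)]) auto
  then have "moment_sequence A ?s" by (auto simp: moment_sequence_def)
  moreover have "\<forall>s. moment_sequence A s \<longrightarrow>
      (\<exists>k\<le>caratheodory_number A. \<exists>\<mu>. atomic_measure k \<mu> \<and> representing_measure A s \<mu>)"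
    unfolding caratheodory_number_def
    by (rule LeastI[of _ "card A"]) (use moment_sequence_has_atomic_measure[OF assms(1,2)] in blast)
  ultimately obtain k \<mu> where k: "k \<le> caratheodory_number A" "atomic_measure k \<mu>" "representing_measure A ?s \<mu>"
    by blast
  then obtain c x where cx: "\<forall>i<k. 0 < c i" "\<mu> = atoms_measure k c x" unfolding atomic_measure_iff by blast
  have "\<forall>f\<in>A. (\<Sum>x\<in>T. w x * f x) = (\<Sum>i<k. c i * f (x i))"
    using k(3) unfolding cx(2)
    by (subst (asm) representing_measure_atoms_measure[OF assms(1,2)]) (use cx(1) in \<open>auto intro: less_imp_le\<close>)
  moreover have "(\<Sum>i<caratheodory_number A. (if i < k then c i else 0) * f (x i)) = (\<Sum>i<k. c i * f (x i))" for f
    using k(1) by (intro sum.mono_neutral_cong_right) auto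
  ultimately show ?thesis using cx(1)
    by (intro exI[of _ "\<lambda>i. if i < k then c i else 0"] exI[of _ x]) (auto intro: less_imp_le)
qed

section \<open>Polynomial functions\<close>

text \<open>The real algebra of functions generated by \<open>S\<close>. With coordinate functions as generators its
  elements are the polynomial functions, so that facts about polynomials in several variables can be
  proved by induction and no normal form is needed.\<close>

inductive_set subalgebra :: "('a \<Rightarrow> real) set \<Rightarrow> ('a \<Rightarrow> real) set" for S where
  const: "(\<lambda>_. c) \<in> subalgebra S"
| gen: "g \<in> S \<Longrightarrow> g \<in> subalgebra S"
| add: "f \<in> subalgebra S \<Longrightarrow> h \<in> subalgebra S \<Longrightarrow> (\<lambda>z. f z + h z) \<in> subalgebra S"
| mult: "f \<in> subalgebra S \<Longrightarrow> h \<in> subalgebra S \<Longrightarrow> (\<lambda>z. f z * h z) \<in> subalgebra S"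

definition polynomial_functions :: "'i set \<Rightarrow> (('i \<Rightarrow> real) \<Rightarrow> real) set" where
  "polynomial_functions Q = subalgebra ((\<lambda>q z. z q) ` Q)"

lemma subalgebra_mono: "S \<subseteq> T \<Longrightarrow> subalgebra S \<subseteq> subalgebra T"
proof
  fix f assume "S \<subseteq> T" "f \<in> subalgebra S"
  from this(2,1) show "f \<in> subalgebra T"
    by (induction) (auto intro: subalgebra.intros)
qed

lemma polynomial_functions_mono: "Q \<subseteq> R \<Longrightarrow> polynomial_functions Q \<subseteq> polynomial_functions R"
  unfolding polynomial_functions_def by (intro subalgebra_mono image_mono)

lemma subalgebra_trans: "f \<in> subalgebra S \<Longrightarrow> S \<subseteq> subalgebra T \<Longrightarrow> f \<in> subalgebra T"
  by (induction rule: subalgebra.induct) (auto intro: subalgebra.intros)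

lemma subalgebra_sum:
  "(\<And>i. i \<in> I \<Longrightarrow> f i \<in> subalgebra S) \<Longrightarrow> (\<lambda>z. \<Sum>i\<in>I. f i z) \<in> subalgebra S"
  by (induction I rule: infinite_finite_induct) (auto intro: subalgebra.intros)

lemma subalgebra_prod:
  "(\<And>i. i \<in> I \<Longrightarrow> f i \<in> subalgebra S) \<Longrightarrow> (\<lambda>z. \<Prod>i\<in>I. f i z) \<in> subalgebra S"
  by (induction I rule: infinite_finite_induct) (auto intro: subalgebra.intros)

lemma subalgebra_power: "f \<in> subalgebra S \<Longrightarrow> (\<lambda>z. f z ^ n) \<in> subalgebra S"
  by (induction n) (auto intro: subalgebra.intros)

lemma coordinate_in_polynomial_functions: "q \<in> Q \<Longrightarrow> (\<lambda>z. z q) \<in> polynomial_functions Q"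
  by (auto simp: polynomial_functions_def intro: subalgebra.gen)

text \<open>Algebra elements generated by the components of a map \<open>\<Phi>\<close> are polynomials in these components.\<close>

lemma subalgebra_comp:
  assumes "f \<in> subalgebra ((\<lambda>q z. \<Phi> z q) ` Q)"
  shows "\<exists>p\<in>polynomial_functions Q. f = (\<lambda>z. p (\<Phi> z))"
  using assms
proof (induction rule: subalgebra.induct)
  case (const c)
  then show ?case
    by (intro bexI[of _ "\<lambda>_. c"]) (auto simp: polynomial_functions_def intro: subalgebra.const)
next
  case (gen g)
  then obtain q where "q \<in> Q" "g = (\<lambda>z. \<Phi> z q)" by auto
  then show ?case
    by (intro bexI[of _ "\<lambda>y. y q"]) (auto intro: coordinate_in_polynomial_functions)
next
  case (add f h)
  then obtain p r where "p \<in> polynomial_functions Q" "f = (\<lambda>z. p (\<Phi> z))"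
    "r \<in> polynomial_functions Q" "h = (\<lambda>z. r (\<Phi> z))" by blast
  then show ?case
    by (intro bexI[of _ "\<lambda>y. p y + r y"]) (auto simp: polynomial_functions_def intro: subalgebra.add)
next
  case (mult f h)
  then obtain p r where "p \<in> polynomial_functions Q" "f = (\<lambda>z. p (\<Phi> z))"
    "r \<in> polynomial_functions Q" "h = (\<lambda>z. r (\<Phi> z))" by blast
  then show ?case
    by (intro bexI[of _ "\<lambda>y. p y * r y"]) (auto simp: polynomial_functions_def intro: subalgebra.mult)
qed

lemma polynomial_functions_cong:
  assumes "f \<in> polynomial_functions Q" "\<forall>q\<in>Q. y q = z q"
  shows "f y = f z"
  using assms(1) unfolding polynomial_functions_def
  by (induction rule: subalgebra.induct) (use assms(2) in auto)

lemma polynomial_functions_on_line: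
  assumes "f \<in> polynomial_functions Q"
  shows "\<exists>p. \<forall>t. f (\<lambda>q. a q + t * v q) = poly p t"
  using assms unfolding polynomial_functions_def
proof (induction rule: subalgebra.induct)
  case (const c)
  show ?case by (intro exI[of _ "[:c:]"]) auto
next
  case (gen g)
  then obtain q where "g = (\<lambda>z. z q)" by auto
  then show ?case by (intro exI[of _ "[:a q, v q:]"]) auto
next
  case (add f h)
  then obtain p r where "\<forall>t. f (\<lambda>q. a q + t * v q) = poly p t" "\<forall>t. h (\<lambda>q. a q + t * v q) = poly r t" by blast
  then show ?case by (intro exI[of _ "p + r"]) auto
next
  case (mult f h)
  then obtain p r where "\<forall>t. f (\<lambda>q. a q + t * v q) = poly p t" "\<forall>t. h (\<lambda>q. a q + t * v q) = poly r t" by blast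
  then show ?case by (intro exI[of _ "p * r"]) auto
qed

lemma polynomial_functions_eq_zero_along_line:
  assumes "f \<in> polynomial_functions Q" "0 < \<epsilon>"
    and "\<And>t. 0 < t \<Longrightarrow> t < \<epsilon> \<Longrightarrow> f (\<lambda>q. a q + t * v q) = 0"
  shows "f (\<lambda>q. a q + t * v q) = 0"
proof -
  obtain p where p: "\<And>t. f (\<lambda>q. a q + t * v q) = poly p t"
    using polynomial_functions_on_line[OF assms(1), of a v] by blast
  have "{0<..<\<epsilon>} \<subseteq> {t. poly p t = 0}" using assms(3) p by auto
  then have "infinite {t. poly p t = 0}" using assms(2) infinite_Ioo finite_subset by blast
  then have "p = 0" using poly_roots_finite by blast
  then show ?thesis by (simp add: p)
qed

text \<open>On the line through a nonzero of either factor, both are nonzero polynomials in one variable.\<close>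

lemma polynomial_functions_no_zero_divisors:
  assumes "f \<in> polynomial_functions Q" "h \<in> polynomial_functions Q" "f y \<noteq> 0" "h z \<noteq> 0"
  shows "\<exists>w. f w * h w \<noteq> 0"
proof -
  define l where "l t = (\<lambda>q. y q + t * (z q - y q))" for t
  obtain p where p: "\<And>t. f (l t) = poly p t"
    using polynomial_functions_on_line[OF assms(1), of y "\<lambda>q. z q - y q"] unfolding l_def by blast
  obtain r where r: "\<And>t. h (l t) = poly r t"
    using polynomial_functions_on_line[OF assms(2), of y "\<lambda>q. z q - y q"] unfolding l_def by blast
  have "l 0 = y" "l 1 = z" by (auto simp: l_def)
  then have "p \<noteq> 0" "r \<noteq> 0" using p[of 0] r[of 1] assms by auto
  then have "p * r \<noteq> 0" by simp
  then obtain t where "poly (p * r) t \<noteq> 0" using poly_all_0_iff_0 by blast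
  then show ?thesis by (intro exI[of _ "l t"]) (simp add: p r)
qed

lemma polynomial_functions_common_nonzero:
  assumes "finite I" "\<And>i. i \<in> I \<Longrightarrow> f i \<in> polynomial_functions Q \<and> (\<exists>z. f i z \<noteq> 0)"
  shows "\<exists>z. (\<Prod>i\<in>I. f i z) \<noteq> 0"
  using assms
proof (induction I rule: finite_induct)
  case (insert i I)
  then obtain y z where "f i y \<noteq> 0" "(\<Prod>i\<in>I. f i z) \<noteq> 0" by blast
  moreover have "(\<lambda>z. \<Prod>i\<in>I. f i z) \<in> polynomial_functions Q"
    using insert.prems unfolding polynomial_functions_def by (intro subalgebra_prod) auto
  ultimately show ?case
    using polynomial_functions_no_zero_divisors[of "f i" Q "\<lambda>z. \<Prod>i\<in>I. f i z" y z] insert by auto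
qed auto

lemma segment_from_ones_positive:
  fixes z :: "'i \<Rightarrow> real"
  assumes "finite Q"
  shows "\<exists>\<epsilon>>0. \<forall>t q. 0 < t \<longrightarrow> t < \<epsilon> \<longrightarrow> q \<in> Q \<longrightarrow> 0 < 1 + t * (z q - 1)"
proof -
  \<comment> \<open>The summand \<open>1\<close> makes \<open>b\<close> positive and the bounds by \<open>b\<close> strict.\<close>
  define b where "b = 1 + (\<Sum>q\<in>Q. \<bar>z q - 1\<bar>)"
  have "0 < b" by (simp add: b_def add_pos_nonneg sum_nonneg)
  have "0 < 1 + t * (z q - 1)" if t: "0 < t" "t < 1 / b" and q: "q \<in> Q" for t q
  proof -
    have "\<bar>z q - 1\<bar> < b"
      using member_le_sum[OF q, of "\<lambda>q. \<bar>z q - 1\<bar>"] assms by (auto simp: b_def)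
    then have "t * \<bar>z q - 1\<bar> \<le> t * b" using t by (intro mult_left_mono) auto
    moreover have "t * b < 1" using t \<open>0 < b\<close> by (simp add: field_simps)
    moreover have "- (t * (z q - 1)) \<le> t * \<bar>z q - 1\<bar>"
      using t by (metis abs_ge_minus_self abs_mult abs_of_pos)
    ultimately show ?thesis by linarith
  qed
  then show ?thesis using \<open>0 < b\<close> by (intro exI[of _ "1 / b"]) simp
qed

text \<open>Otherwise the function vanishes on a small segment that starts in \<open>(1, \<dots>, 1)\<close> and points to
  \<open>z\<close>, hence in \<open>z\<close>.\<close>

lemma polynomial_functions_nonzero_at_positive:
  assumes "f \<in> polynomial_functions Q" "finite Q" "f z \<noteq> 0"
  shows "\<exists>w. (\<forall>q\<in>Q. 0 < w q) \<and> f w \<noteq> 0"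
proof (rule ccontr)
  assume "\<not> ?thesis"
  then have contra: "\<And>w. \<forall>q\<in>Q. 0 < w q \<Longrightarrow> f w = 0" by blast
  obtain \<epsilon> where \<epsilon>: "0 < \<epsilon>" "\<And>t q. 0 < t \<Longrightarrow> t < \<epsilon> \<Longrightarrow> q \<in> Q \<Longrightarrow> 0 < 1 + t * (z q - 1)"
    using segment_from_ones_positive[OF assms(2), of z] by blast
  have near: "f (\<lambda>q. 1 + t * (z q - 1)) = 0" if "0 < t" "t < \<epsilon>" for t
    using \<epsilon>(2) that by (intro contra) simp
  have "f (\<lambda>q. 1 + 1 * (z q - 1)) = 0"
    by (rule polynomial_functions_eq_zero_along_line[OF assms(1) \<epsilon>(1)]) (rule near)
  then show False using assms(3) by simp
qed

text \<open>The chain rule, in the only case that matters: a direction in which all generators are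
  stationary is one in which every polynomial in them is.\<close>

lemma subalgebra_derivative_zero:
  assumes "f \<in> subalgebra S"
    and "\<And>g. g \<in> S \<Longrightarrow> ((\<lambda>t. g (\<lambda>q. z q + t * v q)) has_real_derivative 0) (at 0)"
  shows "((\<lambda>t. f (\<lambda>q. z q + t * v q)) has_real_derivative 0) (at 0)"
  using assms(1)
proof (induction rule: subalgebra.induct)
  case (const c)
  show ?case by (rule DERIV_const)
next
  case (gen g)
  then show ?case using assms(2) by blast
next
  case (add f h)
  from DERIV_add[OF add.IH] show ?case by simp
next
  case (mult f h)
  from DERIV_mult[OF mult.IH] show ?case by simp
qed

lemma polynomial_functions_gradient:
  assumes "f \<in> polynomial_functions Q" "finite Q"
  shows "\<exists>d. \<forall>v. ((\<lambda>t. f (\<lambda>q. z q + t * v q)) has_real_derivative (\<Sum>q\<in>Q. d q * v q)) (at 0)"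
  using assms(1) unfolding polynomial_functions_def
proof (induction rule: subalgebra.induct)
  case (const c)
  show ?case by (intro exI[of _ "\<lambda>_. 0"]) simp
next
  case (gen g)
  then obtain p where p: "p \<in> Q" "g = (\<lambda>z. z p)" by auto
  have "(\<Sum>q\<in>Q. (if q = p then 1 else 0) * v q) = v p" for v :: "_ \<Rightarrow> real"
    using p assms(2) by (simp add: if_distrib[of "\<lambda>c. c * _"] cong: if_cong)
  then show ?case
    by (intro exI[of _ "\<lambda>q. if q = p then 1 else 0"]) (auto simp: p intro!: derivative_eq_intros)
next
  case (add f h)
  then obtain d e where
    d: "\<And>v. ((\<lambda>t. f (\<lambda>q. z q + t * v q)) has_real_derivative (\<Sum>q\<in>Q. d q * v q)) (at 0)" and
    e: "\<And>v. ((\<lambda>t. h (\<lambda>q. z q + t * v q)) has_real_derivative (\<Sum>q\<in>Q. e q * v q)) (at 0)" by blast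
  show ?case
  proof (intro exI allI)
    fix v
    show "((\<lambda>t. f (\<lambda>q. z q + t * v q) + h (\<lambda>q. z q + t * v q)) has_real_derivative
        (\<Sum>q\<in>Q. (d q + e q) * v q)) (at 0)"
      using DERIV_add[OF d[of v] e[of v]] by (simp add: algebra_simps sum.distrib)
  qed
next
  case (mult f h)
  then obtain d e where
    d: "\<And>v. ((\<lambda>t. f (\<lambda>q. z q + t * v q)) has_real_derivative (\<Sum>q\<in>Q. d q * v q)) (at 0)" and
    e: "\<And>v. ((\<lambda>t. h (\<lambda>q. z q + t * v q)) has_real_derivative (\<Sum>q\<in>Q. e q * v q)) (at 0)" by blast
  show ?case
  proof (intro exI allI)
    fix v
    show "((\<lambda>t. f (\<lambda>q. z q + t * v q) * h (\<lambda>q. z q + t * v q)) has_real_derivative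
        (\<Sum>q\<in>Q. (h z * d q + f z * e q) * v q)) (at 0)"
      using DERIV_mult[OF d[of v] e[of v]]
      by (simp add: algebra_simps sum.distrib sum_distrib_left sum_distrib_right)
  qed
qed

section \<open>Algebraic independence and the Jacobian criterion\<close>

definition algebraic_over :: "('a \<Rightarrow> real) set \<Rightarrow> ('a \<Rightarrow> real) \<Rightarrow> bool" where
  "algebraic_over B h \<longleftrightarrow> (\<exists>n b. (\<forall>i<n. b i \<in> B) \<and> (\<exists>i<n. \<exists>z. b i z \<noteq> 0) \<and>
     (\<forall>z. (\<Sum>i<n. b i z * h z ^ i) = 0))"

text \<open>Each function is transcendental over the algebra generated by the later ones. That this excludes
  all polynomial relations is \<open>algebraically_independent_no_relation\<close>; this form makes it immediate
  to extend an independent list.\<close>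

fun algebraically_independent :: "('a \<Rightarrow> real) list \<Rightarrow> bool" where
  "algebraically_independent [] \<longleftrightarrow> True"
| "algebraically_independent (g # gs) \<longleftrightarrow>
     algebraically_independent gs \<and> \<not> algebraic_over (subalgebra (set gs)) g"

lemma algebraic_over_mono: "algebraic_over B h \<Longrightarrow> B \<subseteq> B' \<Longrightarrow> algebraic_over B' h"
  unfolding algebraic_over_def by (meson subsetD)

lemma algebraic_over_generator: "h \<in> S \<Longrightarrow> algebraic_over (subalgebra S) h"
proof -
  assume "h \<in> S"
  define b where "b i = (if i = 0 then (\<lambda>z. - 1 * h z) else (\<lambda>_. 1))" for i :: nat
  have "b i \<in> subalgebra S" for i
    using subalgebra.mult[OF subalgebra.const[of "-1"] subalgebra.gen[OF \<open>h \<in> S\<close>]]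
    by (simp add: b_def subalgebra.const)
  moreover have "(\<Sum>i<2. b i z * h z ^ i) = 0" for z by (simp add: b_def numeral_2_eq_2)
  moreover have "\<exists>i<2. \<exists>z. b i z \<noteq> 0" by (intro exI[of _ 1]) (simp add: b_def)
  ultimately show ?thesis unfolding algebraic_over_def by blast
qed

text \<open>Adding a coordinate whenever it is not yet algebraic produces a transcendence basis that extends
  the given functions.\<close>

lemma maximal_independent_extension:
  fixes gs :: "(('i \<Rightarrow> real) \<Rightarrow> real) list"
  assumes "finite Q" "algebraically_independent gs"
  shows "\<exists>js. distinct js \<and> set js \<subseteq> Q \<and> algebraically_independent (map (\<lambda>q z. z q) js @ gs) \<and>
    (\<forall>q\<in>Q. algebraic_over (subalgebra (set (map (\<lambda>q z. z q) js @ gs))) (\<lambda>z. z q))"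
  using assms(1)
proof (induction Q rule: finite_induct)
  case empty
  then show ?case using assms(2) by (intro exI[of _ "[]"]) auto
next
  case (insert p Q)
  then obtain js where js: "distinct js" "set js \<subseteq> Q"
    "algebraically_independent (map (\<lambda>q z. z q) js @ gs)"
    "\<forall>q\<in>Q. algebraic_over (subalgebra (set (map (\<lambda>q z. z q) js @ gs))) (\<lambda>z. z q)" by blast
  show ?case
  proof (cases "algebraic_over (subalgebra (set (map (\<lambda>q z. z q) js @ gs))) (\<lambda>z. z p)")
    case True
    then show ?thesis using js by (intro exI[of _ js]) auto
  next
    case False
    have bigger: "subalgebra (set (map (\<lambda>q z. z q) js @ gs)) \<subseteq> subalgebra (set (map (\<lambda>q z. z q) (p # js) @ gs))"
      by (rule subalgebra_mono) auto
    then have "algebraic_over (subalgebra (set (map (\<lambda>q z. z q) (p # js) @ gs))) (\<lambda>z. z q)"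
      if "q \<in> insert p Q" for q
    proof (cases "q = p")
      case True
      then show ?thesis by (intro algebraic_over_generator) simp
    next
      case False
      then show ?thesis using that js(4) algebraic_over_mono[OF _ bigger] by blast
    qed
    then show ?thesis using js False insert.hyps by (intro exI[of _ "p # js"]) auto
  qed
qed

text \<open>Separability in characteristic zero. Let \<open>\<Sum>i<n. b i * (z p) ^ i = 0\<close> be a relation with least \<open>n\<close>.
  Its formal derivative \<open>e\<close> with respect to the last variable is not zero by minimality. Along a
  direction \<open>v\<close> in which the generators, hence all \<open>b i\<close>, are stationary, differentiating the
  relation leaves \<open>e z * v p = 0\<close>.\<close>

lemma algebraic_relation_derivative:
  assumes "algebraic_over (subalgebra S) (\<lambda>z. z p)" "S \<subseteq> polynomial_functions Q" "p \<in> Q"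
  shows "\<exists>e\<in>polynomial_functions Q. (\<exists>z. e z \<noteq> 0) \<and> (\<forall>z v. e z \<noteq> 0 \<longrightarrow>
    (\<forall>g\<in>S. ((\<lambda>t. g (\<lambda>q. z q + t * v q)) has_real_derivative 0) (at 0)) \<longrightarrow> v p = 0)"
proof -
  define rel where "rel n b \<longleftrightarrow> (\<forall>i<n. b i \<in> subalgebra S) \<and> (\<exists>i<n. \<exists>z. b i z \<noteq> 0) \<and>
     (\<forall>z. (\<Sum>i<n. b i z * z p ^ i) = 0)" for n and b :: "nat \<Rightarrow> ('a \<Rightarrow> real) \<Rightarrow> real"
  define n where "n = (LEAST n. \<exists>b. rel n b)"
  have "\<exists>n b. rel n b" using assms(1) by (simp add: algebraic_over_def rel_def)
  then have "\<exists>b. rel n b" unfolding n_def by (rule LeastI_ex)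
  then obtain b where b: "\<And>i. i < n \<Longrightarrow> b i \<in> subalgebra S" "\<exists>i<n. \<exists>z. b i z \<noteq> 0"
     "\<And>z. (\<Sum>i<n. b i z * z p ^ i) = 0" by (auto simp: rel_def)
  have minimal: "\<not> rel n' b'" if "n' < n" for n' b' using that not_less_Least unfolding n_def by blast
  have poly: "subalgebra S \<subseteq> polynomial_functions Q"
    using assms(2) subalgebra_trans unfolding polynomial_functions_def by blast
  obtain n' where n': "n = Suc n'" using b(2) by (cases n) auto
  define b' where "b' i z = of_nat (Suc i) * b (Suc i) z" for i z
  define e where "e z = (\<Sum>i<n'. b' i z * z p ^ i)" for z
  have b'_alg: "b' i \<in> subalgebra S" if "i < n'" for i
    unfolding b'_def using b(1) that n' by (intro subalgebra.mult subalgebra.const) auto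
  have "\<exists>z. e z \<noteq> 0"
  proof (rule ccontr)
    assume "\<not> (\<exists>z. e z \<noteq> 0)"
    then have "\<forall>i<n'. \<forall>z. b' i z = 0" using minimal[of n' b'] b'_alg n' by (auto simp: rel_def e_def)
    then have higher: "\<forall>i<n'. \<forall>z. b (Suc i) z = 0" unfolding b'_def by (simp del: of_nat_Suc)
    have "b 0 z = 0" for z using b(3)[of z] higher by (simp add: n' sum.lessThan_Suc_shift del: sum.lessThan_Suc)
    then have "\<forall>i<n. \<forall>z. b i z = 0" using higher n' by (metis Suc_less_eq gr0_conv_Suc not_gr0)
    then show False using b(2) by blast
  qed
  moreover have "e \<in> polynomial_functions Q"
  proof -
    have "b' i \<in> polynomial_functions Q" if "i < n'" for i using b'_alg[OF that] poly by blast
    then show ?thesis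
      using coordinate_in_polynomial_functions[OF assms(3)] unfolding polynomial_functions_def e_def
      by (intro subalgebra_sum subalgebra.mult subalgebra_power) auto
  qed
  moreover have "v p = 0" if ez: "e z \<noteq> 0"
    and van: "\<forall>g\<in>S. ((\<lambda>t. g (\<lambda>q. z q + t * v q)) has_real_derivative 0) (at 0)" for z v
  proof -
    have "((\<lambda>t. b i (\<lambda>q. z q + t * v q) * (z p + t * v p) ^ i) has_real_derivative
        b i z * (of_nat i * z p ^ (i - 1) * v p)) (at 0)" if "i < n" for i
    proof -
      have "((\<lambda>t. (z p + t * v p) ^ i) has_real_derivative of_nat i * z p ^ (i - 1) * v p) (at 0)"
        by (auto intro!: derivative_eq_intros)
      from DERIV_mult[OF subalgebra_derivative_zero[OF b(1)[OF that]] this, of z v] van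
      show ?thesis by (simp add: mult.commute)
    qed
    then have sum_deriv: "((\<lambda>t. \<Sum>i<n. b i (\<lambda>q. z q + t * v q) * (z p + t * v p) ^ i) has_real_derivative
        (\<Sum>i<n. b i z * (of_nat i * z p ^ (i - 1) * v p))) (at 0)"
      by (intro DERIV_sum) auto
    have "(\<lambda>t. \<Sum>i<n. b i (\<lambda>q. z q + t * v q) * (z p + t * v p) ^ i) = (\<lambda>_. 0)"
      using b(3)[of "\<lambda>q. z q + _ * v q"] by auto
    from DERIV_unique[OF sum_deriv[unfolded this] DERIV_const]
    have "(\<Sum>i<n. b i z * (of_nat i * z p ^ (i - 1) * v p)) = 0" .
    moreover have "(\<Sum>i<n. b i z * (of_nat i * z p ^ (i - 1) * v p)) = e z * v p"
      unfolding n' sum.lessThan_Suc_shift by (simp add: e_def b'_def sum_distrib_left mult_ac del: of_nat_Suc)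
    ultimately show ?thesis using ez by simp
  qed
  ultimately show ?thesis by blast
qed

fun list_monomial :: "('a \<Rightarrow> real) list \<Rightarrow> nat list \<Rightarrow> 'a \<Rightarrow> real" where
  "list_monomial (g # gs) (n # ns) z = g z ^ n * list_monomial gs ns z"
| "list_monomial _ _ z = 1"

text \<open>All exponents are bounded separately, instead of their sum, because this makes the number of
  exponent lists exactly \<open>d ^ n\<close>.\<close>

definition exponent_lists :: "nat \<Rightarrow> nat \<Rightarrow> nat list set" where
  "exponent_lists n d = {ns. set ns \<subseteq> {..<d} \<and> length ns = n}"

lemma exponent_lists_Suc: "exponent_lists (Suc n) d = (\<lambda>(i, ns). i # ns) ` ({..<d} \<times> exponent_lists n d)"
  by (auto simp: exponent_lists_def image_iff length_Suc_conv)

lemma list_monomial_in_subalgebra: "list_monomial gs ns \<in> subalgebra (set gs)"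
proof (induction gs arbitrary: ns)
  case Nil
  have "list_monomial [] ns = (\<lambda>_. 1)" by (rule ext) simp
  then show ?case by (simp add: subalgebra.const)
next
  case (Cons g gs)
  show ?case
  proof (cases ns)
    case Nil
    have "list_monomial (g # gs) [] = (\<lambda>_. 1)" by (rule ext) simp
    then show ?thesis by (simp add: subalgebra.const Nil)
  next
    case (Cons n ns')
    have "list_monomial gs ns' \<in> subalgebra (set (g # gs))"
      using \<open>\<And>ns. list_monomial gs ns \<in> subalgebra (set gs)\<close> subalgebra_mono[of "set gs" "set (g # gs)"] by auto
    moreover have "list_monomial (g # gs) ns = (\<lambda>z. g z ^ n * list_monomial gs ns' z)" using Cons by auto
    ultimately show ?thesis by (auto intro!: subalgebra.mult subalgebra_power intro: subalgebra.gen)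
  qed
qed

text \<open>Ordering a relation by powers of the first function, transcendence of this function kills the
  coefficients, which are relations between the remaining functions.\<close>

lemma algebraically_independent_no_relation:
  assumes "algebraically_independent gs"
    and "\<And>z. (\<Sum>ns\<in>exponent_lists (length gs) d. c ns * list_monomial gs ns z) = 0"
    and "ns \<in> exponent_lists (length gs) d"
  shows "c ns = 0"
  using assms
proof (induction gs arbitrary: c ns)
  case Nil
  have "exponent_lists 0 d = {[]}" by (auto simp: exponent_lists_def)
  then show ?case using Nil.prems by simp
next
  case (Cons g gs)
  define b where "b i z = (\<Sum>ns\<in>exponent_lists (length gs) d. c (i # ns) * list_monomial gs ns z)" for i z
  have "(\<Sum>i<d. b i z * g z ^ i) = (\<Sum>ns\<in>exponent_lists (length (g # gs)) d. c ns * list_monomial (g # gs) ns z)" for z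
  proof -
    let ?m = "\<lambda>ns. c ns * list_monomial (g # gs) ns z"
    have "(\<Sum>ns\<in>exponent_lists (length (g # gs)) d. ?m ns)
        = (\<Sum>(i, ns)\<in>{..<d} \<times> exponent_lists (length gs) d. ?m (i # ns))"
      unfolding length_Cons exponent_lists_Suc
      by (subst sum.reindex) (auto simp: inj_on_def intro!: sum.cong)
    also have "\<dots> = (\<Sum>i<d. \<Sum>ns\<in>exponent_lists (length gs) d. ?m (i # ns))"
      by (rule sum.cartesian_product[symmetric])
    also have "\<dots> = (\<Sum>i<d. b i z * g z ^ i)"
      by (auto simp: b_def sum_distrib_left mult_ac intro!: sum.cong)
    finally show ?thesis by simp
  qed
  then have "(\<Sum>i<d. b i z * g z ^ i) = 0" for z using Cons.prems(2) by simp
  moreover have "b i \<in> subalgebra (set gs)" for i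
    unfolding b_def by (intro subalgebra_sum subalgebra.mult subalgebra.const list_monomial_in_subalgebra)
  ultimately have "algebraic_over (subalgebra (set gs)) g" if "i < d" "b i z \<noteq> 0" for i z
    unfolding algebraic_over_def using that by (intro exI[of _ d] exI[of _ b]) auto
  then have "b i z = 0" if "i < d" for i z
    using Cons.prems(1) that by auto
  moreover obtain i ns' where "ns = i # ns'" "i < d" "ns' \<in> exponent_lists (length gs) d"
    using Cons.prems(3) by (auto simp: exponent_lists_Suc)
  ultimately show ?case
    using Cons.IH[of "\<lambda>ns. c (i # ns)" ns'] Cons.prems(1) by (auto simp: b_def)
qed

text \<open>Polynomial functions with degree at most \<open>D\<close> in each variable. Unlike \<open>subalgebra\<close> this exhibits
  them as combinations of finitely many monomials, which is what the dimension count needs.\<close>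

definition box_polynomials :: "'i set \<Rightarrow> nat \<Rightarrow> (('i \<Rightarrow> real) \<Rightarrow> real) set" where
  "box_polynomials Q D =
     {f. \<exists>a. f = (\<lambda>z. \<Sum>\<beta>\<in>PiE Q (\<lambda>_. {..D}). a \<beta> * (\<Prod>q\<in>Q. z q ^ \<beta> q))}"

lemma box_polynomials_add:
  assumes "f \<in> box_polynomials Q D" "h \<in> box_polynomials Q D"
  shows "(\<lambda>z. f z + h z) \<in> box_polynomials Q D"
proof -
  obtain a b where "f = (\<lambda>z. \<Sum>\<beta>\<in>PiE Q (\<lambda>_. {..D}). a \<beta> * (\<Prod>q\<in>Q. z q ^ \<beta> q))"
    "h = (\<lambda>z. \<Sum>\<beta>\<in>PiE Q (\<lambda>_. {..D}). b \<beta> * (\<Prod>q\<in>Q. z q ^ \<beta> q))"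
    using assms by (auto simp: box_polynomials_def)
  then show ?thesis unfolding box_polynomials_def
    by (intro CollectI exI[of _ "\<lambda>\<beta>. a \<beta> + b \<beta>"]) (simp add: distrib_right sum.distrib)
qed

lemma box_polynomials_sum:
  "finite I \<Longrightarrow> (\<And>i. i \<in> I \<Longrightarrow> f i \<in> box_polynomials Q D) \<Longrightarrow> (\<lambda>z. \<Sum>i\<in>I. f i z) \<in> box_polynomials Q D"
proof (induction I rule: finite_induct)
  case empty
  show ?case unfolding box_polynomials_def by (intro CollectI exI[of _ "\<lambda>_. 0"]) simp
next
  case (insert i I)
  then show ?case by (simp add: box_polynomials_add)
qed

lemma box_polynomials_monomial:
  assumes "finite Q" "\<beta> \<in> PiE Q (\<lambda>_. {..D})"
  shows "(\<lambda>z. c * (\<Prod>q\<in>Q. z q ^ \<beta> q)) \<in> box_polynomials Q D"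
  unfolding box_polynomials_def
proof (intro CollectI exI ext)
  fix z :: "'a \<Rightarrow> real"
  show "c * (\<Prod>q\<in>Q. z q ^ \<beta> q)
      = (\<Sum>\<gamma>\<in>PiE Q (\<lambda>_. {..D}). (if \<gamma> = \<beta> then c else 0) * (\<Prod>q\<in>Q. z q ^ \<gamma> q))"
    using assms by (simp add: if_distrib[of "\<lambda>c. c * _"] finite_PiE cong: if_cong)
qed

lemma box_polynomials_mult:
  assumes "finite Q" "f \<in> box_polynomials Q D" "h \<in> box_polynomials Q E"
  shows "(\<lambda>z. f z * h z) \<in> box_polynomials Q (D + E)"
proof -
  obtain a b where ab: "f = (\<lambda>z. \<Sum>\<beta>\<in>PiE Q (\<lambda>_. {..D}). a \<beta> * (\<Prod>q\<in>Q. z q ^ \<beta> q))"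
    "h = (\<lambda>z. \<Sum>\<gamma>\<in>PiE Q (\<lambda>_. {..E}). b \<gamma> * (\<Prod>q\<in>Q. z q ^ \<gamma> q))"
    using assms by (auto simp: box_polynomials_def)
  have "(\<lambda>z. f z * h z) = (\<lambda>z. \<Sum>\<beta>\<in>PiE Q (\<lambda>_. {..D}). \<Sum>\<gamma>\<in>PiE Q (\<lambda>_. {..E}).
      (a \<beta> * b \<gamma>) * (\<Prod>q\<in>Q. z q ^ (\<lambda>q\<in>Q. \<beta> q + \<gamma> q) q))"
    unfolding ab sum_product
    by (intro ext sum.cong refl) (simp add: power_add prod.distrib mult_ac)
  also have "\<dots> \<in> box_polynomials Q (D + E)"
    using assms(1)
    by (intro box_polynomials_sum box_polynomials_monomial finite_PiE) (auto simp: PiE_iff extensional_def intro!: add_mono)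
  finally show ?thesis .
qed

lemma box_polynomials_const: "finite Q \<Longrightarrow> (\<lambda>_. c) \<in> box_polynomials Q D"
  using box_polynomials_monomial[of Q "\<lambda>q\<in>Q. 0" D c] by simp

lemma box_polynomials_mono: "finite Q \<Longrightarrow> D \<le> E \<Longrightarrow> f \<in> box_polynomials Q D \<Longrightarrow> f \<in> box_polynomials Q E"
  using box_polynomials_mult[OF _ _ box_polynomials_const[of Q 1 "E - D"], of f D] by simp

lemma box_polynomials_power:
  assumes "finite Q" "f \<in> box_polynomials Q D"
  shows "(\<lambda>z. f z ^ n) \<in> box_polynomials Q (n * D)"
  by (induction n) (use assms box_polynomials_mult box_polynomials_const in auto)

lemma polynomial_functions_box:
  assumes "finite Q" "f \<in> polynomial_functions Q"
  shows "\<exists>D. f \<in> box_polynomials Q D"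
  using assms(2) unfolding polynomial_functions_def
proof (induction rule: subalgebra.induct)
  case (const c)
  show ?case using box_polynomials_const[OF assms(1)] by blast
next
  case (gen g)
  then obtain p where p: "p \<in> Q" "g = (\<lambda>z. z p)" by auto
  have "(\<Prod>q\<in>Q. z q ^ (\<lambda>q\<in>Q. if q = p then 1 else 0) q) = z p" for z :: "'a \<Rightarrow> real"
  proof -
    have "(\<Prod>q\<in>Q. z q ^ (\<lambda>q\<in>Q. if q = p then 1 else 0) q) = (\<Prod>q\<in>Q. if q = p then z q else 1)"
      by (intro prod.cong) auto
    then show ?thesis using p assms(1) by simp
  qed
  moreover have "(\<lambda>z. 1 * (\<Prod>q\<in>Q. z q ^ (\<lambda>q\<in>Q. if q = p then 1 else 0) q)) \<in> box_polynomials Q 1"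
    using assms(1) by (intro box_polynomials_monomial) auto
  ultimately have "(\<lambda>z. z p) \<in> box_polynomials Q 1" by simp
  then show ?case using p by blast
next
  case (add f h)
  then obtain D E where DE: "f \<in> box_polynomials Q D" "h \<in> box_polynomials Q E" by blast
  have "f \<in> box_polynomials Q (D + E)" "h \<in> box_polynomials Q (D + E)"
    using box_polynomials_mono[OF assms(1) _ DE(1)] box_polynomials_mono[OF assms(1) _ DE(2)] by simp_all
  then show ?case using box_polynomials_add by blast
next
  case (mult f h)
  then show ?case using box_polynomials_mult[OF assms(1)] by blast
qed

lemma list_monomial_box:
  assumes "finite Q" "set gs \<subseteq> box_polynomials Q e" "ns \<in> exponent_lists (length gs) d"
  shows "list_monomial gs ns \<in> box_polynomials Q (length gs * (d * e))"
  using assms(2,3)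
proof (induction gs arbitrary: ns)
  case Nil
  have "list_monomial [] ns = (\<lambda>_. 1)" by (rule ext) simp
  then show ?case using box_polynomials_const[OF assms(1)] by simp
next
  case (Cons g gs)
  then obtain n ns' where ns: "ns = n # ns'" "n < d" "ns' \<in> exponent_lists (length gs) d"
    by (auto simp: exponent_lists_Suc)
  have "(\<lambda>z. g z ^ n) \<in> box_polynomials Q (n * e)"
    using Cons.prems by (intro box_polynomials_power assms(1)) simp
  then have "(\<lambda>z. g z ^ n) \<in> box_polynomials Q (d * e)"
    using ns(2) by (elim box_polynomials_mono[OF assms(1), rotated]) simp
  from box_polynomials_mult[OF assms(1) this Cons.IH[OF _ ns(3)]] Cons.prems
  have "(\<lambda>z. g z ^ n * list_monomial gs ns' z) \<in> box_polynomials Q (length (g # gs) * (d * e))" by simp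
  moreover have "list_monomial (g # gs) ns = (\<lambda>z. g z ^ n * list_monomial gs ns' z)" using ns by auto
  ultimately show ?case by simp
qed

text \<open>The transcendence degree bound, by counting. The \<open>d ^ n\<close> monomials with exponents below \<open>d\<close> in \<open>n\<close>
  given polynomials are combinations of \<open>(n d e + 1) ^ card Q\<close> monomials in the variables, where \<open>e\<close>
  bounds the degrees of the given polynomials. If \<open>n > card Q\<close>, the former number is larger for
  large \<open>d\<close>, and a linear dependence between the former monomials is an algebraic relation.\<close>

lemma algebraically_independent_length_le:
  fixes gs :: "(('i \<Rightarrow> real) \<Rightarrow> real) list"
  assumes "finite Q" "set gs \<subseteq> polynomial_functions Q" "algebraically_independent gs"
  shows "length gs \<le> card Q"
proof (rule ccontr)
  assume "\<not> length gs \<le> card Q"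
  then have gt: "card Q < length gs" by simp
  have "\<exists>e. set gs \<subseteq> box_polynomials Q e"
    using assms(2)
  proof (induction gs)
    case (Cons g gs)
    then obtain e where e: "set gs \<subseteq> box_polynomials Q e" by auto
    obtain D where D: "g \<in> box_polynomials Q D" using polynomial_functions_box[OF assms(1), of g] Cons.prems by auto
    show ?case
      using box_polynomials_mono[OF assms(1), of e "e + D"] box_polynomials_mono[OF assms(1), of D "e + D"] e D
      by (intro exI[of _ "e + D"]) auto
  qed simp
  then obtain e where e: "set gs \<subseteq> box_polynomials Q e" by blast
  define n where "n = length gs"
  \<comment> \<open>Chosen such that \<open>(n * (d * e) + 1) ^ card Q \<le> d ^ card Q * (n * e + 1) ^ card Q < d ^ Suc (card Q)\<close>.\<close>
  define d where "d = (n * e + 1) ^ card Q + 1"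
  define B where "B = PiE Q (\<lambda>_. {..n * (d * e)})"
  have fin: "finite B" "finite (exponent_lists n d)"
    using assms(1) by (auto simp: B_def exponent_lists_def finite_PiE intro: finite_lists_length_eq)
  have "card B = (n * (d * e) + 1) ^ card Q" unfolding B_def by (simp add: card_PiE assms(1))
  also have "\<dots> \<le> (d * (n * e + 1)) ^ card Q" by (intro power_mono) (auto simp: d_def algebra_simps)
  also have "\<dots> = d ^ card Q * (n * e + 1) ^ card Q" by (simp only: power_mult_distrib)
  also have "\<dots> < d ^ card Q * d" by (intro mult_strict_left_mono) (auto simp: d_def)
  also have "\<dots> = d ^ Suc (card Q)" by simp
  also have "\<dots> \<le> d ^ n" using gt by (intro power_increasing) (auto simp: n_def d_def)
  also have "\<dots> = card (exponent_lists n d)" by (simp add: exponent_lists_def card_lists_length_eq)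
  finally have less: "card B < card (exponent_lists n d)" .
  have "\<exists>a. list_monomial gs ns = (\<lambda>z. \<Sum>\<beta>\<in>B. a \<beta> * (\<Prod>q\<in>Q. z q ^ \<beta> q))" if "ns \<in> exponent_lists n d" for ns
    using list_monomial_box[OF assms(1) e, of ns d] that by (simp add: box_polynomials_def n_def B_def)
  then obtain a where a: "\<And>ns. ns \<in> exponent_lists n d \<Longrightarrow>
      list_monomial gs ns = (\<lambda>z. \<Sum>\<beta>\<in>B. a ns \<beta> * (\<Prod>q\<in>Q. z q ^ \<beta> q))" by metis
  obtain u where u: "\<exists>ns\<in>exponent_lists n d. u ns \<noteq> 0"
    "\<forall>\<beta>\<in>B. (\<Sum>ns\<in>exponent_lists n d. u ns * a ns \<beta>) = 0"
    using homogeneous_system_nontrivial[OF fin less, of "\<lambda>\<beta> ns. a ns \<beta>"] by blast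
  have "(\<Sum>ns\<in>exponent_lists n d. u ns * list_monomial gs ns z) = 0" for z
  proof -
    have "(\<Sum>ns\<in>exponent_lists n d. u ns * list_monomial gs ns z)
        = (\<Sum>ns\<in>exponent_lists n d. \<Sum>\<beta>\<in>B. u ns * a ns \<beta> * (\<Prod>q\<in>Q. z q ^ \<beta> q))"
      by (intro sum.cong refl) (simp add: a sum_distrib_left mult.assoc)
    also have "\<dots> = (\<Sum>\<beta>\<in>B. (\<Sum>ns\<in>exponent_lists n d. u ns * a ns \<beta>) * (\<Prod>q\<in>Q. z q ^ \<beta> q))"
      by (subst sum.swap) (simp add: sum_distrib_right)
    also have "\<dots> = 0" using u(2) by (intro sum.neutral) auto
    finally show ?thesis .
  qed
  then show False
    using algebraically_independent_no_relation[OF assms(3), where d = d and c = u] u(1) unfolding n_def by blast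
qed

text \<open>Full rank of the Jacobian matrix at some positive point, in a form without matrices: after
  deleting the columns in \<open>J\<close>, at least \<open>length gs\<close> columns remain, and they form an injective
  matrix. The set \<open>J\<close> consists of the coordinates that extend \<open>gs\<close> to a transcendence basis. All
  coordinates are algebraic over this basis, so where the derivatives of the minimal relations do
  not vanish, a direction that is stationary for the basis is zero.\<close>

lemma jacobian_criterion:
  fixes gs :: "(('i \<Rightarrow> real) \<Rightarrow> real) list"
  assumes "finite Q" "set gs \<subseteq> polynomial_functions Q" "algebraically_independent gs"
  shows "\<exists>z J. (\<forall>q\<in>Q. 0 < z q) \<and> J \<subseteq> Q \<and> card J + length gs \<le> card Q \<and>
    (\<forall>v. (\<forall>g\<in>set gs. ((\<lambda>t. g (\<lambda>q. z q + t * v q)) has_real_derivative 0) (at 0)) \<longrightarrow>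
      (\<forall>q\<in>J. v q = 0) \<longrightarrow> (\<forall>q\<in>Q. v q = 0))"
proof -
  obtain js where js: "distinct js" "set js \<subseteq> Q" "algebraically_independent (map (\<lambda>q z. z q) js @ gs)"
    and alg: "\<And>p. p \<in> Q \<Longrightarrow> algebraic_over (subalgebra (set (map (\<lambda>q z. z q) js @ gs))) (\<lambda>z. z p)"
    using maximal_independent_extension[OF assms(1,3)] by blast
  define S where "S = set (map (\<lambda>q (z :: 'i \<Rightarrow> real). z q) js @ gs)"
  have S: "S \<subseteq> polynomial_functions Q"
    using assms(2) js(2) by (auto simp: S_def intro!: coordinate_in_polynomial_functions)
  define flat where "flat z v \<longleftrightarrow>
    (\<forall>g\<in>S. ((\<lambda>t. g (\<lambda>q. z q + t * v q)) has_real_derivative 0) (at 0))" for z v :: "'i \<Rightarrow> real"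
  have "\<exists>e\<in>polynomial_functions Q. (\<exists>z. e z \<noteq> 0) \<and> (\<forall>z v. e z \<noteq> 0 \<longrightarrow> flat z v \<longrightarrow> v p = 0)"
    if "p \<in> Q" for p
    unfolding flat_def by (rule algebraic_relation_derivative[OF alg[folded S_def] S]) (fact that)+
  then obtain e where e: "\<And>p. p \<in> Q \<Longrightarrow> e p \<in> polynomial_functions Q \<and> (\<exists>z. e p z \<noteq> 0)"
    "\<And>p z v. p \<in> Q \<Longrightarrow> e p z \<noteq> 0 \<Longrightarrow> flat z v \<Longrightarrow> v p = 0"
    by metis
  obtain z0 where "(\<Prod>p\<in>Q. e p z0) \<noteq> 0" using polynomial_functions_common_nonzero[OF assms(1), where f = e, OF e(1)] by blast
  moreover have "(\<lambda>z. \<Prod>p\<in>Q. e p z) \<in> polynomial_functions Q"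
    using e(1) unfolding polynomial_functions_def by (intro subalgebra_prod) auto
  ultimately obtain z where z: "\<forall>q\<in>Q. 0 < z q" "(\<Prod>p\<in>Q. e p z) \<noteq> 0"
    using polynomial_functions_nonzero_at_positive[OF _ assms(1)] by blast
  then have ez: "e p z \<noteq> 0" if "p \<in> Q" for p using that assms(1) by auto
  have "length (map (\<lambda>q (z :: 'i \<Rightarrow> real). z q) js @ gs) \<le> card Q"
    using algebraically_independent_length_le[OF assms(1) _ js(3)] S by (simp add: S_def)
  then have card: "card (set js) + length gs \<le> card Q" by (simp add: distinct_card[OF js(1)])
  have "v p = 0" if v: "\<forall>g\<in>set gs. ((\<lambda>t. g (\<lambda>q. z q + t * v q)) has_real_derivative 0) (at 0)"
      "\<forall>q\<in>set js. v q = 0" and p: "p \<in> Q" for v p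
  proof (rule e(2)[OF p ez[OF p]], unfold flat_def, intro ballI)
    fix g assume "g \<in> S"
    then consider "g \<in> set gs" | q where "q \<in> set js" "g = (\<lambda>z. z q)" by (auto simp: S_def)
    then show "((\<lambda>t. g (\<lambda>q. z q + t * v q)) has_real_derivative 0) (at 0)"
      by cases (use v in auto)
  qed
  then show ?thesis using z(1) js(2) card by (intro exI[of _ z] exI[of _ "set js"]) blast
qed

section \<open>Rank of a matrix with a nonsingular set of columns\<close>

lemma rank_le_dim:
  fixes A :: "real Matrix.mat"
  assumes "A \<in> carrier_mat m nc"
  shows "vec_space.rank m A \<le> m"
proof -
  interpret vec_space "TYPE(real)" m .
  have carr: "set (cols A) \<subseteq> carrier_vec m" using cols_dim assms by blast
  obtain S where S: "maximal S (\<lambda>T. T \<subseteq> set (cols A) \<and> lin_indpt T)"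
    using maximal_exists_superset[of "set (cols A)" "\<lambda>T. T \<subseteq> set (cols A) \<and> lin_indpt T" "{}"]
    by (auto simp: lin_dep_def)
  then have "S \<subseteq> set (cols A)" "lin_indpt S" by (auto simp: maximal_def)
  then have "card S \<le> dim" using li_le_dim(2)[OF fin_dim, of S] carr by auto
  then show ?thesis using rank_card_indpt[OF assms S] dim_is_n by simp
qed

text \<open>Injectivity bounds the number of columns in \<open>P\<close> by \<open>m\<close>, so they form a square matrix with
  nonzero determinant.\<close>

lemma full_rank_if_injective_on_columns:
  fixes c :: "'q \<Rightarrow> real Matrix.vec"
  assumes "distinct qs" "P \<subseteq> set qs" "m \<le> card P"
    and inj: "\<And>v. (\<And>i. i < m \<Longrightarrow> (\<Sum>q\<in>P. v q * vec_index (c q) i) = 0) \<Longrightarrow> \<forall>q\<in>P. v q = 0"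
    and "\<And>q. q \<in> set qs \<Longrightarrow> c q \<in> carrier_vec m"
  shows "vec_space.rank m (mat_of_cols m (map c qs)) = m"
proof -
  interpret vec_space "TYPE(real)" m .
  define A where "A = mat_of_cols m (map c qs)"
  have A: "A \<in> carrier_mat m (length qs)" by (simp add: A_def mat_of_cols_def)
  have "finite P" using assms(2) finite_subset by blast
  have "card P = m"
  proof (rule antisym)
    show "card P \<le> m"
    proof (rule ccontr)
      assume "\<not> card P \<le> m"
      then obtain u where u: "\<exists>q\<in>P. u q \<noteq> 0" "\<forall>i\<in>{..<m}. (\<Sum>q\<in>P. u q * vec_index (c q) i) = 0"
        using homogeneous_system_nontrivial[of "{..<m}" P "\<lambda>i q. vec_index (c q) i"] \<open>finite P\<close> by auto
      have "\<forall>q\<in>P. u q = 0" by (rule inj) (use u(2) in simp)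
      then show False using u(1) by blast
    qed
  qed (rule assms(3))
  obtain ps where ps: "distinct ps" "set ps = P" using finite_distinct_list[OF \<open>finite P\<close>] by blast
  then have len: "length ps = m" using \<open>card P = m\<close> distinct_card by fastforce
  define B where "B = mat_of_cols m (map c ps)"
  have B: "B \<in> carrier_mat m m" by (simp add: B_def mat_of_cols_def len)
  have "det B \<noteq> 0"
  proof
    assume "det B = 0"
    then obtain v where v: "v \<in> carrier_vec m" "v \<noteq> 0\<^sub>v m" "B *\<^sub>v v = 0\<^sub>v m"
      using det_0_iff_vec_prod_zero_field[OF B] by blast
    have "bij_betw (\<lambda>j. ps ! j) {..<m} P" using bij_betw_nth[OF ps(1)] ps(2) len by blast
    then have inj_nth: "inj_on (\<lambda>j. ps ! j) {..<m}"
      and img: "(\<lambda>j. ps ! j) ` {..<m} = P"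
      by (auto simp: bij_betw_def)
    define w where "w q = vec_index v (the_inv_into {..<m} (\<lambda>j. ps ! j) q)" for q
    have w: "w (ps ! j) = vec_index v j" if "j < m" for j
      using the_inv_into_f_f[OF inj_nth] that by (simp add: w_def)
    have w_kernel: "(\<Sum>q\<in>P. w q * vec_index (c q) i) = 0" if i: "i < m" for i
    proof -
      have "(\<Sum>q\<in>P. w q * vec_index (c q) i) = (\<Sum>j<m. w (ps ! j) * vec_index (c (ps ! j)) i)"
        unfolding img[symmetric] by (subst sum.reindex[OF inj_nth]) simp
      also have "\<dots> = vec_index (B *\<^sub>v v) i"
        using i B v(1) len
        by (auto simp: scalar_prod_def B_def mat_of_cols_index w mult.commute atLeast0LessThan intro!: sum.cong)
      also have "\<dots> = 0" using v(3) i by simp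
      finally show ?thesis .
    qed
    have "\<forall>q\<in>P. w q = 0" by (rule inj) (rule w_kernel)
    then have "vec_index v j = 0" if "j < m" for j using w that ps(2) len nth_mem by metis
    then have "v = 0\<^sub>v m" using v(1) by (intro eq_vecI) auto
    then show False using v(2) by simp
  qed
  then have "rank B = m" using det_rank_iff[OF B] by blast
  then have "distinct (cols B)" using non_distinct_low_rank[OF B] by force
  then have indpt: "lin_indpt (set (cols B))" using full_rank_lin_indpt[OF B \<open>rank B = m\<close>] by blast
  have "cols B = map c ps" unfolding B_def using assms(2,5) ps(2) by (intro cols_mat_of_cols) auto
  moreover have "cols A = map c qs" unfolding A_def using assms(5) by (intro cols_mat_of_cols) auto
  ultimately have "set (cols B) \<subseteq> set (cols A)" using assms(2) ps(2) by auto
  then have "card (set (cols B)) \<le> rank A" using rank_ge_card_indpt[OF A _ indpt] by blast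
  moreover have "card (set (cols B)) = m" using distinct_card[OF \<open>distinct (cols B)\<close>] B by simp
  ultimately show ?thesis using rank_le_dim[OF A] unfolding A_def by simp
qed

section \<open>Functions whose moment cone is covered\<close>

definition linearly_independent_functions :: "('a \<Rightarrow> real) set \<Rightarrow> bool" where
  "linearly_independent_functions A \<longleftrightarrow>
     (\<forall>l. (\<forall>x. (\<Sum>f\<in>A. l f * f x) = 0) \<longrightarrow> (\<forall>f\<in>A. l f = 0))"

text \<open>Otherwise a nonzero functional is nonnegative on the values at all points and on their negatives,
  which makes it a linear relation between the functions.\<close>

lemma evaluations_span:
  assumes "finite A" "linearly_independent_functions A"
  shows "\<exists>T w. finite T \<and> (\<forall>f\<in>A. y f = (\<Sum>x\<in>T. w x * f x))"
proof -
  \<comment> \<open>Signed points: with the signs \<open>1\<close> and \<open>-1\<close> the cone generated by the values is a linear space.\<close>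
  define g :: "('a \<Rightarrow> real) \<Rightarrow> 'a \<times> real \<Rightarrow> real" where "g f p = snd p * f (fst p)" for f p
  have "\<exists>T c. finite T \<and> T \<subseteq> UNIV \<times> {1, -1} \<and> (\<forall>p\<in>T. 0 \<le> c p) \<and> (\<forall>f\<in>A. y f = (\<Sum>p\<in>T. c p * g f p))"
  proof (rule ccontr)
    assume "\<not> ?thesis"
    from separate_from_cone_hull[OF assms(1) this] obtain l
      where l: "\<exists>f\<in>A. l f \<noteq> 0" "\<forall>p\<in>UNIV \<times> {1, -1}. 0 \<le> (\<Sum>f\<in>A. l f * g f p)" by blast
    have "(\<Sum>f\<in>A. l f * f x) = 0" for x
    proof (rule antisym)
      have "0 \<le> (\<Sum>f\<in>A. l f * g f (x, 1))" using l(2) by blast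
      then show "0 \<le> (\<Sum>f\<in>A. l f * f x)" by (simp add: g_def)
      have "0 \<le> (\<Sum>f\<in>A. l f * g f (x, -1))" using l(2) by blast
      then show "(\<Sum>f\<in>A. l f * f x) \<le> 0" by (simp add: g_def sum_negf)
    qed
    then show False using assms(2) l(1) unfolding linearly_independent_functions_def by blast
  qed
  then obtain T c where T: "finite T" "\<forall>f\<in>A. y f = (\<Sum>p\<in>T. c p * g f p)" by blast
  define w where "w x = (\<Sum>p\<in>{p\<in>T. fst p = x}. c p * snd p)" for x
  have "(\<Sum>p\<in>T. c p * g f p) = (\<Sum>x\<in>fst ` T. w x * f x)" for f
    by (subst sum.image_gen[OF T(1), of _ fst])
       (auto simp: w_def g_def sum_distrib_right mult.assoc intro!: sum.cong)
  then show ?thesis using T by (intro exI[of _ "fst ` T"] exI[of _ w]) auto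
qed

text \<open>Any \<open>y\<close> is a combination of moment vectors with real weights. The line from the combination
  with all weights \<open>1\<close> to \<open>y\<close> starts inside the cone, so \<open>P\<close> vanishes on it.\<close>

lemma polynomial_vanishing_on_moment_cone:
  fixes A :: "('a \<Rightarrow> real) set"
  assumes "finite A" "linearly_independent_functions A" "P \<in> polynomial_functions A"
    and vanish: "\<And>T w. finite T \<Longrightarrow> \<forall>x\<in>T. 0 \<le> w x \<Longrightarrow> P (\<lambda>f. \<Sum>x\<in>T. w x * f x) = 0"
  shows "P y = 0"
proof -
  obtain T w where T: "finite T" "\<forall>f\<in>A. y f = (\<Sum>x\<in>T. w x * f x)"
    using evaluations_span[OF assms(1,2)] by blast
  obtain \<epsilon> where \<epsilon>: "0 < \<epsilon>" "\<And>t x. 0 < t \<Longrightarrow> t < \<epsilon> \<Longrightarrow> x \<in> T \<Longrightarrow> 0 < 1 + t * (w x - 1)"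
    using segment_from_ones_positive[OF T(1), of w] by blast
  define a where "a f = (\<Sum>x\<in>T. f x)" for f :: "'a \<Rightarrow> real"
  have near: "P (\<lambda>f. a f + t * (y f - a f)) = 0" if t: "0 < t" "t < \<epsilon>" for t
  proof -
    have "P (\<lambda>f. a f + t * (y f - a f)) = P (\<lambda>f. \<Sum>x\<in>T. (1 + t * (w x - 1)) * f x)"
      using T(2) by (intro polynomial_functions_cong[OF assms(3)])
        (auto simp: a_def algebra_simps sum.distrib sum_subtractf sum_distrib_left)
    also have "\<dots> = 0" using \<epsilon>(2)[OF t] by (intro vanish T(1)) (auto intro: less_imp_le)
    finally show ?thesis .
  qed
  have "P (\<lambda>f. a f + 1 * (y f - a f)) = 0"
    by (rule polynomial_functions_eq_zero_along_line[OF assms(3) \<epsilon>(1)]) (rule near)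
  then show ?thesis by simp
qed

text \<open>A relation between the \<open>F f\<close> is a polynomial \<open>P\<close> that vanishes on the image of \<open>F\<close>, hence on
  the cone and everywhere. As the coefficients do not involve the last variable, they are zero.\<close>

lemma independent_if_moment_cone_covered:
  fixes A :: "('a \<Rightarrow> real) set" and F :: "('a \<Rightarrow> real) \<Rightarrow> 'z \<Rightarrow> real"
  assumes A: "finite A" "linearly_independent_functions A"
    and cover: "\<And>T w. finite T \<Longrightarrow> \<forall>x\<in>T. 0 \<le> w x \<Longrightarrow> \<exists>z. \<forall>f\<in>A. (\<Sum>x\<in>T. w x * f x) = F f z"
    and "distinct fs" "set fs \<subseteq> A"
  shows "algebraically_independent (map F fs)"
  using assms(4,5)
proof (induction fs)
  case (Cons f fs)
  define \<Phi> where "\<Phi> z g = F g z" for z g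
  have "\<not> algebraic_over (subalgebra (F ` set fs)) (F f)"
  proof
    assume "algebraic_over (subalgebra (F ` set fs)) (F f)"
    then obtain n b where b: "\<And>i. i < n \<Longrightarrow> b i \<in> subalgebra (F ` set fs)" "\<exists>i<n. \<exists>z. b i z \<noteq> 0"
      "\<And>z. (\<Sum>i<n. b i z * F f z ^ i) = 0" unfolding algebraic_over_def by blast
    have "F ` set fs = (\<lambda>g z. \<Phi> z g) ` set fs" by (simp add: \<Phi>_def)
    then have "\<exists>p\<in>polynomial_functions (set fs). b i = (\<lambda>z. p (\<Phi> z))" if "i < n" for i
      using subalgebra_comp b(1)[OF that] by metis
    then obtain \<beta> where \<beta>: "\<And>i. i < n \<Longrightarrow> \<beta> i \<in> polynomial_functions (set fs)"
      "\<And>i. i < n \<Longrightarrow> b i = (\<lambda>z. \<beta> i (\<Phi> z))" by metis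
    define P where "P y = (\<Sum>i<n. \<beta> i y * y f ^ i)" for y
    have \<beta>A: "\<beta> i \<in> polynomial_functions A" if "i < n" for i
      using \<beta>(1)[OF that] polynomial_functions_mono[of "set fs" A] Cons.prems by auto
    have P: "P \<in> polynomial_functions A"
      using \<beta>A coordinate_in_polynomial_functions[of f A] Cons.prems
      unfolding polynomial_functions_def P_def
      by (intro subalgebra_sum subalgebra.mult subalgebra_power) auto
    have P_zero: "P y = 0" for y
    proof (rule polynomial_vanishing_on_moment_cone[OF A P])
      fix T :: "'a set" and w :: "'a \<Rightarrow> real"
      assume "finite T" "\<forall>x\<in>T. 0 \<le> w x"
      from cover[OF this] obtain z where "\<forall>f\<in>A. (\<Sum>x\<in>T. w x * f x) = F f z" by blast
      then have "P (\<lambda>f. \<Sum>x\<in>T. w x * f x) = P (\<Phi> z)"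
        by (intro polynomial_functions_cong[OF P]) (simp add: \<Phi>_def)
      also have "\<dots> = 0" using b(3)[of z] by (simp add: P_def \<Phi>_def \<beta>(2))
      finally show "P (\<lambda>f. \<Sum>x\<in>T. w x * f x) = 0" .
    qed
    have "\<beta> i y = 0" if i: "i < n" for i y
    proof -
      obtain m where m: "n = Suc m" using i by (cases n) auto
      have "(\<Sum>i\<le>m. \<beta> i y * t ^ i) = 0" for t
      proof -
        have "(\<Sum>i\<le>m. \<beta> i y * t ^ i) = (\<Sum>i<n. \<beta> i (y(f := t)) * (y(f := t)) f ^ i)"
          unfolding m lessThan_Suc_atMost
        proof (intro sum.cong refl)
          fix i assume "i \<in> {..m}"
          then have "\<beta> i (y(f := t)) = \<beta> i y"
            using Cons.prems m by (intro polynomial_functions_cong[OF \<beta>(1)]) auto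
          then show "\<beta> i y * t ^ i = \<beta> i (y(f := t)) * (y(f := t)) f ^ i" by simp
        qed
        then show ?thesis using P_zero[of "y(f := t)"] by (simp add: P_def)
      qed
      then show ?thesis using polyfun_eq_0[of "\<lambda>i. \<beta> i y" m] i m by auto
    qed
    then show False using b(2) \<beta>(2) by auto
  qed
  then show ?case using Cons by simp
qed simp

section \<open>Linear independence of monomials\<close>

text \<open>By induction on the variables, reading off coefficients of powers of one of them.\<close>

lemma monomial_functions_independent:
  fixes c :: "('i \<Rightarrow> nat) \<Rightarrow> real"
  assumes "finite I"
    and "\<And>x :: 'i \<Rightarrow> real. (\<Sum>\<alpha>\<in>PiE I (\<lambda>_. {..d}). c \<alpha> * (\<Prod>i\<in>I. x i ^ \<alpha> i)) = 0"
    and "\<alpha> \<in> PiE I (\<lambda>_. {..d})"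
  shows "c \<alpha> = 0"
  using assms
proof (induction I arbitrary: c \<alpha> rule: finite_induct)
  case empty
  then show ?case by simp
next
  case (insert j I)
  let ?E = "PiE I (\<lambda>_. {..d})"
  have inj: "inj_on (\<lambda>(n, \<beta>). \<beta>(j := n)) ({..d} \<times> ?E)"
    using inj_combinator[of j I] insert.hyps(2) by auto
  have expand: "(\<Sum>\<alpha>\<in>PiE (insert j I) (\<lambda>_. {..d}). c \<alpha> * (\<Prod>i\<in>insert j I. x i ^ \<alpha> i))
      = (\<Sum>n\<le>d. (\<Sum>\<beta>\<in>?E. c (\<beta>(j := n)) * (\<Prod>i\<in>I. x i ^ \<beta> i)) * x j ^ n)" for x :: "'i \<Rightarrow> real"
  proof -
    have "(\<Prod>i\<in>insert j I. x i ^ (\<beta>(j := n)) i) = (\<Prod>i\<in>I. x i ^ \<beta> i) * x j ^ n" for \<beta> n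
    proof -
      have "(\<Prod>i\<in>I. x i ^ (\<beta>(j := n)) i) = (\<Prod>i\<in>I. x i ^ \<beta> i)"
        using insert.hyps(2) by (intro prod.cong) auto
      then show ?thesis using insert.hyps by simp
    qed
    then show ?thesis
      unfolding PiE_insert_eq
      by (subst sum.reindex[OF inj])
         (simp add: case_prod_unfold sum.cartesian_product sum_distrib_right mult.assoc)
  qed
  have coeff: "(\<Sum>\<beta>\<in>?E. c (\<beta>(j := n)) * (\<Prod>i\<in>I. x i ^ \<beta> i)) = 0" if "n \<le> d" for n and x :: "'i \<Rightarrow> real"
  proof -
    have "(\<Sum>n\<le>d. (\<Sum>\<beta>\<in>?E. c (\<beta>(j := n)) * (\<Prod>i\<in>I. x i ^ \<beta> i)) * t ^ n) = 0" for t
    proof -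
      have "(\<Prod>i\<in>I. (x(j := t)) i ^ \<beta> i) = (\<Prod>i\<in>I. x i ^ \<beta> i)" for \<beta> :: "'i \<Rightarrow> nat"
        using insert.hyps(2) by (intro prod.cong) auto
      then show ?thesis
        using insert.prems(1)[of "x(j := t)"] unfolding expand by simp
    qed
    then have "\<forall>n\<le>d. (\<Sum>\<beta>\<in>?E. c (\<beta>(j := n)) * (\<Prod>i\<in>I. x i ^ \<beta> i)) = 0"
      by (subst polyfun_eq_0[symmetric]) (rule allI)
    then show ?thesis using that by blast
  qed
  obtain n \<beta> where \<alpha>: "\<alpha> = \<beta>(j := n)" "n \<le> d" "\<beta> \<in> ?E"
    using insert.prems(2) unfolding PiE_insert_eq by auto
  show ?case
    unfolding \<alpha>(1)
    by (rule insert.IH[of "\<lambda>\<beta>. c (\<beta>(j := n))" \<beta>, OF coeff[OF \<alpha>(2)] \<alpha>(3)])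
qed

definition monomial :: "('n::finite \<Rightarrow> nat) \<Rightarrow> real ^ 'n \<Rightarrow> real" where
  "monomial \<alpha> x = (\<Prod>i\<in>UNIV. (x $ i) ^ \<alpha> i)"

definition degree_at_most :: "nat \<Rightarrow> ('n::finite \<Rightarrow> nat) set" where
  "degree_at_most d = {\<alpha>. (\<Sum>i\<in>UNIV. \<alpha> i) \<le> d}"

lemma monomials_eq: "monomials d = monomial ` degree_at_most d"
  unfolding monomials_def degree_at_most_def monomial_def by auto

lemma degree_at_most_box: "degree_at_most d \<subseteq> PiE UNIV (\<lambda>_. {..d})"
proof
  fix \<alpha> :: "'n::finite \<Rightarrow> nat"
  assume "\<alpha> \<in> degree_at_most d"
  then have "\<alpha> i \<le> d" for i
    using member_le_sum[of i UNIV \<alpha>] by (simp add: degree_at_most_def)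
  then show "\<alpha> \<in> PiE UNIV (\<lambda>_. {..d})" by (intro PiE_I) auto
qed

lemma finite_degree_at_most: "finite (degree_at_most d)"
  using finite_subset[OF degree_at_most_box] by (simp add: finite_PiE)

lemma monomial_combination_zero:
  fixes c :: "('n::finite \<Rightarrow> nat) \<Rightarrow> real"
  assumes "E \<subseteq> degree_at_most d" "\<And>x. (\<Sum>\<alpha>\<in>E. c \<alpha> * monomial \<alpha> x) = 0" "\<alpha> \<in> E"
  shows "c \<alpha> = 0"
proof -
  let ?B = "PiE (UNIV :: 'n set) (\<lambda>_. {..d})"
  have "(if \<alpha> \<in> E then c \<alpha> else 0) = 0"
  proof (rule monomial_functions_independent[where I = UNIV and d = d
      and c = "\<lambda>\<alpha>. if \<alpha> \<in> E then c \<alpha> else 0"])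
    show "\<alpha> \<in> ?B" using assms(1,3) degree_at_most_box by blast
    fix x :: "'n \<Rightarrow> real"
    have "(\<Sum>\<alpha>\<in>?B. (if \<alpha> \<in> E then c \<alpha> else 0) * (\<Prod>i\<in>UNIV. x i ^ \<alpha> i))
        = (\<Sum>\<alpha>\<in>E. c \<alpha> * monomial \<alpha> (\<chi> i. x i))"
      using assms(1) degree_at_most_box
      by (intro sum.mono_neutral_cong_right) (auto simp: finite_PiE monomial_def)
    then show "(\<Sum>\<alpha>\<in>?B. (if \<alpha> \<in> E then c \<alpha> else 0) * (\<Prod>i\<in>UNIV. x i ^ \<alpha> i)) = 0"
      using assms(2) by simp
  qed simp
  then show ?thesis using assms(3) by simp
qed

lemma inj_monomial: "inj (monomial :: ('n::finite \<Rightarrow> nat) \<Rightarrow> real ^ 'n \<Rightarrow> real)"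
proof (rule injI, rule ccontr)
  fix \<alpha> \<beta> :: "'n \<Rightarrow> nat"
  assume eq: "(monomial \<alpha> :: real ^ 'n \<Rightarrow> real) = monomial \<beta>" and ne: "\<alpha> \<noteq> \<beta>"
  let ?c = "\<lambda>\<gamma>. if \<gamma> = \<alpha> then 1 else -1 :: real"
  have "?c \<alpha> = 0"
  proof (rule monomial_combination_zero[where c = ?c])
    show "{\<alpha>, \<beta>} \<subseteq> degree_at_most (sum \<alpha> UNIV + sum \<beta> UNIV)" by (auto simp: degree_at_most_def)
    show "(\<Sum>\<gamma>\<in>{\<alpha>, \<beta>}. ?c \<gamma> * monomial \<gamma> x) = 0" for x :: "real ^ 'n"
      using ne fun_cong[OF eq, of x] by simp
  qed simp
  then show False by simp
qed

lemma finite_monomials: "finite (monomials d)"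
  by (simp add: monomials_eq finite_degree_at_most)

lemma monomials_independent:
  "linearly_independent_functions (monomials d :: (real ^ 'n::finite \<Rightarrow> real) set)"
  unfolding linearly_independent_functions_def monomials_eq
proof (intro allI impI ballI)
  fix l :: "(real ^ 'n \<Rightarrow> real) \<Rightarrow> real" and f :: "real ^ 'n \<Rightarrow> real"
  assume l: "\<forall>x. (\<Sum>f\<in>monomial ` degree_at_most d. l f * f x) = 0" and "f \<in> monomial ` degree_at_most d"
  then obtain \<alpha> where \<alpha>: "\<alpha> \<in> degree_at_most d" "f = monomial \<alpha>" by blast
  have "(\<Sum>\<alpha>\<in>degree_at_most d. l (monomial \<alpha>) * monomial \<alpha> x) = 0" for x :: "real ^ 'n"
    using l by (simp add: sum.reindex[OF inj_on_subset[OF inj_monomial subset_UNIV]])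
  from monomial_combination_zero[OF order_refl this \<alpha>(1)] show "l f = 0" unfolding \<alpha>(2) .
qed

lemma monomials_measurable: "monomials d \<subseteq> borel_measurable borel"
  unfolding monomials_def by (auto intro!: borel_measurable_continuous_onI continuous_intros)

lemma card_monomials2: "2 * card (monomials2 d) = (d + 1) * (d + 2)"
proof -
  have "card (monomials2 d) = card (degree_at_most d :: (2 \<Rightarrow> nat) set)"
    unfolding monomials_eq by (intro card_image inj_on_subset[OF inj_monomial]) simp
  also have "\<dots> = card (Sigma {..d} (\<lambda>a. {..d - a}))"
  proof (rule bij_betw_same_card)
    show "bij_betw (\<lambda>\<alpha>. (\<alpha> 1, \<alpha> 2)) (degree_at_most d :: (2 \<Rightarrow> nat) set) (Sigma {..d} (\<lambda>a. {..d - a}))"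
    proof (rule bij_betw_byWitness[where f' = "\<lambda>(a, b) i. if i = 1 then a else b"])
      show "\<forall>\<alpha>\<in>degree_at_most d. (\<lambda>(a, b) i. if i = 1 then a else b) (\<alpha> 1, \<alpha> (2 :: 2)) = (\<alpha> :: 2 \<Rightarrow> nat)"
        by (auto simp: fun_eq_iff) (metis exhaust_2)
    qed (auto simp: degree_at_most_def sum_2)
  qed
  also have "\<dots> = (\<Sum>a\<le>d. d - a + 1)" by simp
  also have "\<dots> = (\<Sum>a\<le>d. a + 1)"
    by (rule sum.reindex_bij_witness[where i = "\<lambda>a. d - a" and j = "\<lambda>a. d - a"]) auto
  finally have "card (monomials2 d) = (\<Sum>a\<le>d. a + 1)" .
  moreover have "2 * (\<Sum>a\<le>d. a + 1) = (d + 1) * (d + 2)" by (induction d) (auto simp: algebra_simps)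
  ultimately show ?thesis by simp
qed

section \<open>The moment map and its derivative\<close>

text \<open>The pair \<open>(i, None)\<close> stands for the weight of atom \<open>i\<close>, and \<open>(i, Some l)\<close> for the coordinate
  \<open>l\<close> of its position; a single argument \<open>z\<close> of the moment map collects all of them.\<close>

definition moment_variables :: "nat \<Rightarrow> (nat \<times> 'n::finite option) set" where
  "moment_variables N = {..<N} \<times> UNIV"

definition moment_point :: "(nat \<times> 'n::finite option \<Rightarrow> real) \<Rightarrow> nat \<Rightarrow> real ^ 'n" where
  "moment_point z i = (\<chi> l. z (i, Some l))"

definition moment_component :: "nat \<Rightarrow> (real ^ 'n::finite \<Rightarrow> real) \<Rightarrow> (nat \<times> 'n option \<Rightarrow> real) \<Rightarrow> real" where
  "moment_component N f z = (\<Sum>i<N. z (i, None) * f (moment_point z i))"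

text \<open>The variables in the order of the columns of the derivative matrix.\<close>

definition moment_variable_list :: "nat \<Rightarrow> (nat \<times> 'n::finite option) list" where
  "moment_variable_list N =
     concat (map (\<lambda>i. (i, None) # map (\<lambda>l. (i, Some l)) (enumeration UNIV)) [0..<N])"

lemma set_moment_variable_list: "set (moment_variable_list N :: (nat \<times> 'n::finite option) list) = moment_variables N"
proof -
  have "insert (i, None) ((\<lambda>l. (i, Some l)) ` (UNIV :: 'n set)) = {i} \<times> UNIV" for i :: nat
    by (auto simp: image_iff)
  then show ?thesis
    by (auto simp: moment_variable_list_def moment_variables_def enumeration)
qed

lemma distinct_moment_variable_list: "distinct (moment_variable_list N :: (nat \<times> 'n::finite option) list)"
proof (induction N)
  case (Suc N)
  have "distinct ((N, None) # map (\<lambda>l. (N, Some l)) (enumeration (UNIV :: 'n set)))"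
    by (auto simp: distinct_map inj_on_def enumeration)
  moreover have "moment_variable_list (Suc N)
      = moment_variable_list N @ (N, None) # map (\<lambda>l. (N, Some l)) (enumeration (UNIV :: 'n set))"
    by (simp add: moment_variable_list_def)
  moreover have "(N, x) \<notin> set (moment_variable_list N)" for x :: "'n option"
    by (simp add: set_moment_variable_list moment_variables_def)
  ultimately show ?case using Suc by auto
qed (simp add: moment_variable_list_def)

lemma moment_component_polynomial:
  fixes f :: "real ^ 'n::finite \<Rightarrow> real"
  assumes "f \<in> monomials d"
  shows "moment_component N f \<in> polynomial_functions (moment_variables N)"
proof -
  obtain \<alpha> where f: "f = monomial \<alpha>" using assms by (auto simp: monomials_eq)
  have coord: "(\<lambda>z. z (i, v)) \<in> polynomial_functions (moment_variables N)" if "i < N" for i and v :: "'n option"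
    using that by (intro coordinate_in_polynomial_functions) (simp add: moment_variables_def)
  have "(\<lambda>z. \<Sum>i<N. z (i, None) * (\<Prod>l\<in>UNIV. z (i, Some l) ^ \<alpha> l)) \<in> polynomial_functions (moment_variables N)"
    using coord unfolding polynomial_functions_def
    by (intro subalgebra_sum subalgebra.mult subalgebra_prod subalgebra_power) auto
  then show ?thesis by (simp add: f moment_component_def[abs_def] monomial_def moment_point_def)
qed

lemma moment_map_index:
  assumes "finite A" "j < card A"
  shows "vec_index (moment_map N A (\<lambda>i. z (i, None)) (moment_point z)) j
    = moment_component N (enumeration A ! j) z"
proof -
  have "length (enumeration A) = card A" using distinct_card enumeration[OF assms(1)] by metis
  then show ?thesis using assms(2)
    by (simp add: moment_map_def moment_vector_def moment_component_def vec_of_list_index del: vec_of_list_map)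
qed

lemma moment_map_coeff_update:
  "(\<lambda>i. z (i, None))(k := u) = (\<lambda>i. (z((k, None) := u)) (i, None))"
  "moment_point z = moment_point (z((k, None) := u))"
  by (auto simp: moment_point_def fun_eq_iff)

lemma moment_map_point_update:
  "(\<lambda>i. z (i, None)) = (\<lambda>i. (z((k, Some l) := u)) (i, None))"
  "(moment_point z)(k := moment_point z k + t *\<^sub>R axis l 1) = moment_point (z((k, Some l) := z (k, Some l) + t))"
  by (auto simp: moment_point_def fun_eq_iff Finite_Cartesian_Product.vec_eq_iff axis_def)

text \<open>The columns are defined by derivatives of one-variable functions; in terms of the single
  argument \<open>z\<close> they are the partial derivatives, that is, the entries of the gradients.\<close>

lemma D_moment_map_eq:
  fixes A :: "(real ^ 'n::finite \<Rightarrow> real) set"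
  assumes "finite A"
    and grad: "\<And>f v. f \<in> A \<Longrightarrow> ((\<lambda>t. moment_component N f (\<lambda>q. z q + t * v q)) has_real_derivative
      (\<Sum>q\<in>moment_variables N. J f q * v q)) (at 0)"
  shows "D_moment_map N A (\<lambda>i. z (i, None)) (moment_point z)
    = mat_of_cols (card A) (map (\<lambda>q. Matrix.vec (card A) (\<lambda>j. J (enumeration A ! j) q)) (moment_variable_list N))"
proof -
  let ?G = "\<lambda>j. moment_component N (enumeration A ! j)"
  let ?c = "\<lambda>q. Matrix.vec (card A) (\<lambda>j. J (enumeration A ! j) q)"
  have len: "length (enumeration A) = card A" using distinct_card enumeration[OF assms(1)] by metis
  have fin: "finite (moment_variables N :: (nat \<times> 'n option) set)" by (simp add: moment_variables_def)
  have partial: "((\<lambda>t. ?G j (z(p := z p + t))) has_real_derivative J (enumeration A ! j) p) (at 0)"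
    if "j < card A" "p \<in> moment_variables N" for j p
  proof -
    have "enumeration A ! j \<in> A" using that(1) len enumeration(2)[OF assms(1)] nth_mem by metis
    from grad[OF this, of "\<lambda>q. if q = p then 1 else 0"]
    have "((\<lambda>t. ?G j (\<lambda>q. z q + t * (if q = p then 1 else 0))) has_real_derivative J (enumeration A ! j) p) (at 0)"
      using that(2) fin by (simp add: if_distrib[of "\<lambda>c. _ * c"] cong: if_cong)
    moreover have "(\<lambda>q. z q + t * (if q = p then 1 else 0)) = z(p := z p + t)" for t by auto
    ultimately show ?thesis by simp
  qed
  have by_coefficient: "deriv_vec (card A) (\<lambda>t. moment_map N A ((\<lambda>i. z (i, None))(i := t)) (moment_point z)) (z (i, None)) = ?c (i, None)"
    if "i < N" for i
    unfolding deriv_vec_def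
  proof (rule eq_vecI)
    fix j assume "j < dim_vec (?c (i, None))"
    then have j: "j < card A" by simp
    have "((\<lambda>t. ?G j (z((i, None) := t + z (i, None)))) has_real_derivative J (enumeration A ! j) (i, None)) (at 0)"
      using partial[OF j, of "(i, None)"] that by (simp add: moment_variables_def add.commute)
    then have "((\<lambda>t. ?G j (z((i, None) := t))) has_real_derivative J (enumeration A ! j) (i, None)) (at (z (i, None)))"
      using DERIV_shift[of "\<lambda>t. ?G j (z((i, None) := t))" _ 0 "z (i, None)"] by simp
    moreover have "vec_index (moment_map N A ((\<lambda>i. z (i, None))(i := t)) (moment_point z)) j = ?G j (z((i, None) := t))" for t
      unfolding moment_map_coeff_update(1) by (subst moment_map_coeff_update(2)[of z i t]) (rule moment_map_index[OF assms(1) j])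
    ultimately show "vec_index (Matrix.vec (card A) (\<lambda>j. deriv (\<lambda>u. vec_index (moment_map N A ((\<lambda>i. z (i, None))(i := u)) (moment_point z)) j) (z (i, None)))) j = vec_index (?c (i, None)) j"
      using j by (simp add: DERIV_imp_deriv del: fun_upd_apply)
  qed simp
  have by_coordinate: "deriv_vec (card A) (\<lambda>t. moment_map N A (\<lambda>i. z (i, None)) ((moment_point z)(i := moment_point z i + t *\<^sub>R axis l 1))) 0 = ?c (i, Some l)"
    if "i < N" for i l
    unfolding deriv_vec_def
  proof (rule eq_vecI)
    fix j assume "j < dim_vec (?c (i, Some l))"
    then have j: "j < card A" by simp
    have "vec_index (moment_map N A (\<lambda>i. z (i, None)) ((moment_point z)(i := moment_point z i + t *\<^sub>R axis l 1))) j
        = ?G j (z((i, Some l) := z (i, Some l) + t))" for t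
      unfolding moment_map_point_update(2)
      by (subst moment_map_point_update(1)[of z i l "z (i, Some l) + t"]) (rule moment_map_index[OF assms(1) j])
    then show "vec_index (Matrix.vec (card A) (\<lambda>j. deriv (\<lambda>u. vec_index (moment_map N A (\<lambda>i. z (i, None)) ((moment_point z)(i := moment_point z i + u *\<^sub>R axis l 1))) j) 0)) j = vec_index (?c (i, Some l)) j"
      using j DERIV_imp_deriv[OF partial[OF j, of "(i, Some l)"]] that
      by (simp add: moment_variables_def del: fun_upd_apply)
  qed simp
  show ?thesis
    unfolding D_moment_map_def moment_variable_list_def map_concat
    by (intro arg_cong[of _ _ "mat_of_cols (card A)"] arg_cong[of _ _ concat])
       (auto simp: by_coefficient by_coordinate simp del: fun_upd_apply)
qed

text \<open>The moment map with \<open>caratheodory_number A\<close> atoms covers the moment cone, so its components are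
  algebraically independent and the Jacobian criterion applies.\<close>

lemma full_rank_at_caratheodory_number:
  fixes d :: nat
  defines "A \<equiv> monomials d :: (real ^ 'n::finite \<Rightarrow> real) set"
  shows "\<exists>C X. (\<forall>i<caratheodory_number A. 0 \<le> C i) \<and>
    vec_space.rank (card A) (D_moment_map (caratheodory_number A) A C X) = card A"
proof -
  define N where "N = caratheodory_number A"
  define Q where "Q = (moment_variables N :: (nat \<times> 'n option) set)"
  define F where "F = (moment_component N :: (real ^ 'n \<Rightarrow> real) \<Rightarrow> _)"
  have finA: "finite A" unfolding A_def by (rule finite_monomials)
  have finQ: "finite Q" by (simp add: Q_def moment_variables_def)
  let ?fs = "enumeration A"
  have len: "length ?fs = card A" using distinct_card enumeration[OF finA] by metis
  have cover: "\<exists>z. \<forall>f\<in>A. (\<Sum>x\<in>T. w x * f x) = F f z" if T: "finite T" "\<forall>x\<in>T. 0 \<le> w x" for T w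
  proof -
    obtain c x where cx: "\<forall>f\<in>A. (\<Sum>x\<in>T. w x * f x) = (\<Sum>i<N. c i * f (x i))"
      using caratheodory_number_attained[OF finA _ T] monomials_measurable unfolding N_def A_def by blast
    define z where "z = (\<lambda>(i, v). case v of None \<Rightarrow> c i | Some l \<Rightarrow> x i $ l)"
    have "moment_point z i = x i" for i by (simp add: moment_point_def z_def)
    then have "F f z = (\<Sum>i<N. c i * f (x i))" for f by (simp add: F_def moment_component_def z_def)
    then show ?thesis using cx by (intro exI[of _ z]) simp
  qed
  have indep: "algebraically_independent (map F ?fs)"
    using independent_if_moment_cone_covered[OF finA _ cover] monomials_independent enumeration[OF finA]
    unfolding A_def by blast
  have poly: "set (map F ?fs) \<subseteq> polynomial_functions Q"
    using moment_component_polynomial enumeration(2)[OF finA] by (auto simp: F_def Q_def A_def)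
  obtain z K where z: "\<forall>q\<in>Q. 0 < z q" and K: "K \<subseteq> Q" "card K + length (map F ?fs) \<le> card Q" and
    flat: "\<And>v. (\<forall>g\<in>set (map F ?fs). ((\<lambda>t. g (\<lambda>q. z q + t * v q)) has_real_derivative 0) (at 0)) \<Longrightarrow>
      (\<forall>q\<in>K. v q = 0) \<Longrightarrow> (\<forall>q\<in>Q. v q = 0)"
    using jacobian_criterion[OF finQ poly indep] by blast
  have "\<forall>f\<in>A. \<exists>d. \<forall>v. ((\<lambda>t. F f (\<lambda>q. z q + t * v q)) has_real_derivative (\<Sum>q\<in>Q. d q * v q)) (at 0)"
    using polynomial_functions_gradient[OF _ finQ] poly enumeration(2)[OF finA] by auto
  from bchoice[OF this] obtain J where J: "\<forall>f\<in>A. \<forall>v.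
      ((\<lambda>t. F f (\<lambda>q. z q + t * v q)) has_real_derivative (\<Sum>q\<in>Q. J f q * v q)) (at 0)" ..
  define c where "c q = Matrix.vec (card A) (\<lambda>j. J (?fs ! j) q)" for q
  have "vec_space.rank (card A) (mat_of_cols (card A) (map c (moment_variable_list N))) = card A"
  proof (rule full_rank_if_injective_on_columns[where P = "Q - K"])
    show "distinct (moment_variable_list N :: (nat \<times> 'n option) list)" by (rule distinct_moment_variable_list)
    show "Q - K \<subseteq> set (moment_variable_list N)" by (auto simp: set_moment_variable_list Q_def)
    have "card (Q - K) = card Q - card K" using K(1) finQ finite_subset by (intro card_Diff_subset) auto
    then show "card A \<le> card (Q - K)" using K(2) len by simp
    show "c q \<in> carrier_vec (card A)" for q by (simp add: c_def)
    fix v assume v: "\<And>i. i < card A \<Longrightarrow> (\<Sum>q\<in>Q - K. v q * vec_index (c q) i) = 0"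
    \<comment> \<open>A relation between the columns outside \<open>K\<close>, read as a direction in the space of all variables.\<close>
    define v' where "v' q = (if q \<in> K then 0 else v q)" for q
    have "(\<Sum>q\<in>Q. J f q * v' q) = 0" if f: "f \<in> A" for f
    proof -
      obtain j where j: "j < card A" "f = ?fs ! j" using f len enumeration(2)[OF finA] in_set_conv_nth by metis
      have "(\<Sum>q\<in>Q. J f q * v' q) = (\<Sum>q\<in>Q - K. v q * vec_index (c q) j)"
        using finQ j by (intro sum.mono_neutral_cong_right) (auto simp: v'_def c_def)
      then show ?thesis using v[OF j(1)] by simp
    qed
    then have "\<forall>f\<in>A. ((\<lambda>t. F f (\<lambda>q. z q + t * v' q)) has_real_derivative 0) (at 0)"
      using J by (metis (no_types, lifting))
    then have "\<forall>g\<in>set (map F ?fs). ((\<lambda>t. g (\<lambda>q. z q + t * v' q)) has_real_derivative 0) (at 0)"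
      by (simp add: enumeration(2)[OF finA])
    from flat[OF this] show "\<forall>q\<in>Q - K. v q = 0" by (auto simp: v'_def)
  qed
  moreover have "D_moment_map N A (\<lambda>i. z (i, None)) (moment_point z)
      = mat_of_cols (card A) (map c (moment_variable_list N))"
    unfolding c_def by (rule D_moment_map_eq[OF finA]) (use J in \<open>simp add: F_def Q_def\<close>)
  ultimately have rank: "vec_space.rank (card A) (D_moment_map N A (\<lambda>i. z (i, None)) (moment_point z)) = card A" by simp
  have "\<forall>i<N. 0 \<le> z (i, None)"
    using z by (auto simp: Q_def moment_variables_def intro: less_imp_le)
  then have "(\<forall>i<N. 0 \<le> z (i, None)) \<and>
      vec_space.rank (card A) (D_moment_map N A (\<lambda>i. z (i, None)) (moment_point z)) = card A" using rank by (rule conjI)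
  then show ?thesis unfolding N_def
    by (intro exI[of _ "\<lambda>i. z (i, None)"] exI[of _ "moment_point z"])
qed

lemma rank_D_moment_map_le:
  fixes A :: "(real ^ 'n::finite \<Rightarrow> real) set"
  shows "vec_space.rank (card A) (D_moment_map k A C X) \<le> k * (CARD('n) + 1)"
proof -
  have len: "length (enumeration (UNIV :: 'n set)) = CARD('n)"
    using distinct_card enumeration finite by metis
  have "length (concat (map (\<lambda>i. g i # map (h i) (enumeration (UNIV :: 'n set))) [0..<k])) = k * (CARD('n) + 1)"
    for g :: "nat \<Rightarrow> real Matrix.vec" and h
    by (induction k) (simp_all add: len algebra_simps)
  then have "D_moment_map k A C X \<in> carrier_mat (card A) (k * (CARD('n) + 1))"
    unfolding D_moment_map_def mat_of_cols_def by simp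
  then show ?thesis by (rule vec_space.rank_le_nc)
qed

text \<open>The Caratheodory number is a candidate for the minimum that defines \<open>DS_number\<close>, so this minimum
  is attained. It has to be positive to be a candidate: with zero atoms the rank would be zero, but
  the constant monomial shows that \<open>A\<close> is not empty.\<close>

lemma DS_number_bounds:
  fixes d :: nat
  defines "A \<equiv> monomials d :: (real ^ 'n::finite \<Rightarrow> real) set"
  shows "card A \<le> DS_number A * (CARD('n) + 1)" and "DS_number A \<le> caratheodory_number A"
proof -
  define full where "full k \<longleftrightarrow> 1 \<le> k \<and> (\<exists>C X. (\<forall>i<k. 0 \<le> C i) \<and>
    vec_space.rank (card A) (D_moment_map k A C X) = card A)" for k
  have DS: "DS_number A = (LEAST k. full k)" by (simp add: DS_number_def full_def)
  obtain C X where CX: "\<forall>i<caratheodory_number A. 0 \<le> C i"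
    "vec_space.rank (card A) (D_moment_map (caratheodory_number A) A C X) = card A"
    using full_rank_at_caratheodory_number[of d, where ?'n = 'n] unfolding A_def by blast
  have "(\<lambda>_. 0) \<in> (degree_at_most d :: ('n \<Rightarrow> nat) set)" by (simp add: degree_at_most_def)
  then have "A \<noteq> {}" unfolding A_def monomials_eq by blast
  then have "0 < card A" using finite_monomials unfolding A_def by (simp add: card_gt_0_iff)
  then have "1 \<le> caratheodory_number A"
    using rank_D_moment_map_le[of A "caratheodory_number A" C X] CX(2) by (cases "caratheodory_number A") auto
  then have full: "full (caratheodory_number A)" using CX unfolding full_def by blast
  then show "DS_number A \<le> caratheodory_number A" unfolding DS by (rule Least_le)
  from full have "full (DS_number A)" unfolding DS by (rule LeastI)
  then obtain C X where "vec_space.rank (card A) (D_moment_map (DS_number A) A C X) = card A"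
    unfolding full_def by blast
  then show "card A \<le> DS_number A * (CARD('n) + 1)"
    using rank_D_moment_map_le[of A "DS_number A" C X] by simp
qed

section \<open>The two chains of inequalities\<close>

lemma card_monomials2_odd:
  assumes "1 \<le> k"
  shows "card (monomials2 (2 * k - 1)) = k * (2 * k + 1)"
proof -
  have "2 * card (monomials2 (2 * k - 1)) = (2 * k) * (2 * k + 1)"
    unfolding card_monomials2 using assms by simp
  then show ?thesis by simp
qed

theorem proposition51:
  fixes k :: nat
  assumes "1 \<le> k"
  shows "(int ((k + 1) choose 2) + \<lfloor>real k / 2\<rfloor>
            \<le> \<lceil>real (card (monomials2 (2 * k - 1))) / 3\<rceil> \<and>
          \<lceil>real (card (monomials2 (2 * k - 1))) / 3\<rceil>
            \<le> int (DS_number (monomials2 (2 * k - 1))) \<and>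
          DS_number (monomials2 (2 * k - 1))
            \<le> caratheodory_number (monomials2 (2 * k - 1))) \<and>
         (4 \<le> k \<longrightarrow>
          real_of_int (\<lceil>real (card (monomials2 (2 * k - 1))) / 3\<rceil>
              - (int ((k + 1) choose 2) + \<lfloor>real k / 2\<rfloor>))
            \<ge> ((real k - 2)\<^sup>2 - 4) / 6)"
proof -
  define m where "m = card (monomials2 (2 * k - 1))"
  have m: "real m = real k * (2 * real k + 1)"
    unfolding m_def card_monomials2_odd[OF assms] by (simp add: algebra_simps)
  have "2 * ((k + 1) choose 2) = (k + 1) * k" by (simp add: choose_two)
  then have "real (2 * ((k + 1) choose 2)) = real ((k + 1) * k)" by (simp only:)
  then have binom: "real ((k + 1) choose 2) = (real k + 1) * real k / 2"
    by (simp add: algebra_simps)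
  define B where "B = int ((k + 1) choose 2) + \<lfloor>real k / 2\<rfloor>"
  have "real_of_int B \<le> (real k + 1) * real k / 2 + real k / 2"
    unfolding B_def using binom by simp linarith
  then have gap: "((real k - 2)\<^sup>2 - 4) / 6 \<le> real m / 3 - real_of_int B"
    by (simp add: m power2_eq_square field_simps)
  have ceil: "real m / 3 \<le> real_of_int \<lceil>real m / 3\<rceil>" by simp
  have "B \<le> \<lceil>real m / 3\<rceil>"
  proof -
    have "- 4 / 6 \<le> ((real k - 2)\<^sup>2 - 4) / 6" by (intro divide_right_mono) simp_all
    then have "-1 < real m / 3 - real_of_int B" using gap by linarith
    then show ?thesis using ceil by linarith
  qed
  moreover have "\<lceil>real m / 3\<rceil> \<le> int (DS_number (monomials2 (2 * k - 1)))"
  proof -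
    have "m \<le> DS_number (monomials2 (2 * k - 1)) * 3"
      unfolding m_def using DS_number_bounds(1)[of "2 * k - 1", where ?'n = 2] by simp
    then have "real m / 3 \<le> real (DS_number (monomials2 (2 * k - 1)))" by simp
    then show ?thesis by (simp add: ceiling_le_iff)
  qed
  moreover have "DS_number (monomials2 (2 * k - 1)) \<le> caratheodory_number (monomials2 (2 * k - 1))"
    by (rule DS_number_bounds(2))
  moreover have "((real k - 2)\<^sup>2 - 4) / 6 \<le> real_of_int (\<lceil>real m / 3\<rceil> - B)"
    unfolding of_int_diff using gap ceil by linarith
  ultimately show ?thesis unfolding m_def B_def by blast
qed

end
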